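(* If $\mathsf p:\mathbb E\to\mathbb B$ is a latent hyperfibration, then so is its fibrational dual $\mathsf p^*:\mathbb E^*\to\mathbb B$.
   Context: Composition is written in diagrammatic order. A restriction category is a category with an operation sending each $f:A\to B$ to $\overline f:A\to A$ such that (R.1) $\overline f f=f$; (R.2) $\overline f\,\overline g=\overline g\,\overline f$ for $f,g$ with the same domain; (R.3) $\overline{\overline f g}=\overline f\,\overline g$ for $f,g$ with the same domain; (R.4) $f\overline g=\overline{fg}\,f$ for composable $f,g$. A restriction idempotent is an endomap $e=\overline e$; $\mathcal O(X)$ is the set of restriction idempotents on $X$. Parallel maps are ordered by $f\le g$ iff $\overline f g=f$. A partial isomorphism is a map $s$ with a (unique) partial inverse $s^{(-1)}$: $ss^{(-1)}=\overline s$, $s^{(-1)}s=\overline{s^{(-1)}}$. A restriction semifunctor preserves domains, codomains, composition and restriction, but not necessarily identities. A commuting triangle $kf=g$ (with left factor $k$) is precise if $\overline g=\overline k$. For a restriction semifunctor $\mathsf p:\mathbb E\to\mathbb B$, an arrow $f':X'\to X$ of $\mathbb E$ is $\mathsf p$-prone if whenever $g:Y\to X$ in $\mathbb E$ and $h:\mathsf p(Y)\to\mathsf p(X')$ in $\mathbb B$ are such that $h\,\mathsf p(f')=\mathsf p(g)$ is precise, there is a unique $\widetilde h:Y\to X'$ with $\mathsf p(\widetilde h)=h$ and $\widetilde h f'=g$ precise. $\mathsf p$ is a latent fibration if for each $X\in\mathbb E$ and $f:A\to\mathsf p(X)$ in $\mathbb B$ with $f=f\,\mathsf p(1_X)$ there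 is a $\mathsf p$-prone $f':X'\to X$ with $\mathsf p(f')=f$. $\mathsf p$ is hyperconnected if for every $X\in\mathbb E$ the map $\mathcal O(X)\to\{d\in\mathcal O(\mathsf p(X)): d\,\mathsf p(1_X)=d\}$, $e\mapsto\mathsf p(e)$, is an isomorphism. A latent hyperfibration (hyperfibration) is a hyperconnected latent fibration. A map $v:X\to Y$ of $\mathbb E$ is subvertical if $\mathsf p(v)$ is a restriction idempotent (so $\mathsf p(X)=\mathsf p(Y)$). A commuting square $f'b=af$ with $f':A'\to B'$, $b:B'\to B$, $a:A'\to A$, $f:A\to B$ is a latent pullback if $f'\overline b=f'$, $a\overline f=a$, and for all $x_0:X\to B'$, $x_1:X\to A$ and every restriction idempotent $e$ on $X$ with $ex_1f=ex_0b$, $e\le\overline{x_1f}$, $e\le\overline{x_0b}$, there is a unique $k:X\to A'$ with $\overline k=e$, $kf'\le x_0$, $ka\le x_1$ and $k\overline{f'}=k\overline a=k$. The fibrational dual of a latent hyperfibration $\mathsf p$: the restriction category $\mathbb E^*$ has the objects of $\mathbb E$; a map $X\to Y$ is an equivalence class $[(v,c)]$ of spans $X\xleftarrow{v}S\xrightarrow{c}Y$ in $\mathbb E$ with $v$ subvertical, $c$ $\mathsf p$-prone and $\overline v=\overline c$. Spans $(v,c)$ with apex $S$ and $(v',c')$ with apex $S'$ are equivalent if there is a subvertical partial isomorphism $\alpha:S\to S'$ with $\alpha v'=v$, $\alpha c'=c$, $\alpha^{(-1)}v=v'$, $\alpha^{(-1)}c=c'$, $\overline\alpha=\overline c$, $\overline{\alpha^{(-1)}}=\overline{c'}$.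 The identity is $[(1_X,1_X)]$. The composite of $[(v_1,c_1)]:X\to Y$ and $[(v_2,c_2)]:Y\to Z$ is $[(v_2^\ast v_1,c_1^\ast c_2)]$, where $(v_2^\ast,c_1^\ast)$ are the legs of a latent pullback of $c_1$ and $v_2$ with $v_2^\ast$ subvertical and $c_1^\ast$ prone (such latent pullbacks exist). The restriction is $\overline{[(v,c)]}=[(\widehat v,\widehat v)]$, where for $v:S\to X$ subvertical $\widehat v$ is the unique restriction idempotent on $X$ with $\mathsf p(\widehat v)=\mathsf p(v)$. The restriction semifunctor $\mathsf p^*:\mathbb E^*\to\mathbb B$ is $\mathsf p^*(A)=\mathsf p(A)$ on objects and $\mathsf p^*([(v,c)])=\mathsf p(c)$ on maps. It may be assumed that $\mathbb E^*$ and $\mathsf p^*$ are well defined. *)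

theory Defs
  imports Main
begin

section \<open>Restriction categories\<close>

record ('o, 'm) rcat =
  Obj :: "'o set"
  Arr :: "'m set"
  Dom :: "'m \<Rightarrow> 'o"
  Cod :: "'m \<Rightarrow> 'o"
  Id :: "'o \<Rightarrow> 'm"
  Comp :: "'m \<Rightarrow> 'm \<Rightarrow> 'm"  (infixl "\<cdot>\<index>" 70)
  Restr :: "'m \<Rightarrow> 'm"  ("\<rho>\<index>")

text \<open>Composition is diagrammatic: \<open>f \<cdot> g\<close> is \<open>f\<close> followed by \<open>g\<close>.  The operations are total
  functions; their values outside the objects, arrows and composable pairs are irrelevant.
  \<open>\<rho> f\<close> is the restriction of \<open>f\<close>, usually written with an overline.\<close>

definition Hom :: "('o, 'm) rcat \<Rightarrow> 'o \<Rightarrow> 'o \<Rightarrow> 'm set" where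
  "Hom C X Y = {f \<in> Arr C. Dom C f = X \<and> Cod C f = Y}"

locale restriction_category =
  fixes C :: "('o, 'm) rcat" (structure)
  assumes Dom_Obj: "f \<in> Arr C \<Longrightarrow> Dom C f \<in> Obj C"
    and Cod_Obj: "f \<in> Arr C \<Longrightarrow> Cod C f \<in> Obj C"
    and Id_Hom: "X \<in> Obj C \<Longrightarrow> Id C X \<in> Hom C X X"
    and Comp_Hom: "\<lbrakk>f \<in> Hom C X Y; g \<in> Hom C Y Z\<rbrakk> \<Longrightarrow> f \<cdot> g \<in> Hom C X Z"
    and Id_left: "f \<in> Hom C X Y \<Longrightarrow> Id C X \<cdot> f = f"
    and Id_right: "f \<in> Hom C X Y \<Longrightarrow> f \<cdot> Id C Y = f"
    and Comp_assoc:
      "\<lbrakk>f \<in> Hom C W X; g \<in> Hom C X Y; h \<in> Hom C Y Z\<rbrakk> \<Longrightarrow> (f \<cdot> g) \<cdot> h = f \<cdot> (g \<cdot> h)"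
    and Restr_Hom: "f \<in> Hom C X Y \<Longrightarrow> \<rho> f \<in> Hom C X X"
    and R1: "f \<in> Hom C X Y \<Longrightarrow> \<rho> f \<cdot> f = f"
    and R2: "\<lbrakk>f \<in> Hom C X Y; g \<in> Hom C X Z\<rbrakk> \<Longrightarrow> \<rho> f \<cdot> \<rho> g = \<rho> g \<cdot> \<rho> f"
    and R3: "\<lbrakk>f \<in> Hom C X Y; g \<in> Hom C X Z\<rbrakk> \<Longrightarrow> \<rho> (\<rho> f \<cdot> g) = \<rho> f \<cdot> \<rho> g"
    and R4: "\<lbrakk>f \<in> Hom C X Y; g \<in> Hom C Y Z\<rbrakk> \<Longrightarrow> f \<cdot> \<rho> g = \<rho> (f \<cdot> g) \<cdot> f"

definition ridem :: "('o, 'm) rcat \<Rightarrow> 'o \<Rightarrow> 'm set" where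
  "ridem C X = {e \<in> Hom C X X. Restr C e = e}"

definition rle :: "('o, 'm) rcat \<Rightarrow> 'm \<Rightarrow> 'm \<Rightarrow> bool" where
  "rle C f g \<longleftrightarrow> f \<in> Arr C \<and> g \<in> Hom C (Dom C f) (Cod C f) \<and> Comp C (Restr C f) g = f"

definition partial_inverse :: "('o, 'm) rcat \<Rightarrow> 'm \<Rightarrow> 'm \<Rightarrow> bool" where
  "partial_inverse C s t \<longleftrightarrow>
     s \<in> Arr C \<and> t \<in> Hom C (Cod C s) (Dom C s) \<and>
     Comp C s t = Restr C s \<and> Comp C t s = Restr C t"

text \<open>The triangle \<open>k \<cdot> f = g\<close> commutes and is precise.\<close>

definition precise_triangle :: "('o, 'm) rcat \<Rightarrow> 'm \<Rightarrow> 'm \<Rightarrow> 'm \<Rightarrow> bool" where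
  "precise_triangle C k f g \<longleftrightarrow>
     k \<in> Arr C \<and> f \<in> Arr C \<and> Cod C k = Dom C f \<and>
     Comp C k f = g \<and> Restr C g = Restr C k"

text \<open>The square \<open>f' \<cdot> b = a \<cdot> f\<close> is a latent pullback, where
  \<open>f' : A' \<rightarrow> B'\<close>, \<open>b : B' \<rightarrow> B\<close>, \<open>a : A' \<rightarrow> A\<close> and \<open>f : A \<rightarrow> B\<close>.\<close>

definition latent_pullback ::
    "('o, 'm) rcat \<Rightarrow> 'm \<Rightarrow> 'm \<Rightarrow> 'm \<Rightarrow> 'm \<Rightarrow> bool" where
  "latent_pullback C f' b a f \<longleftrightarrow>
     f' \<in> Arr C \<and> b \<in> Arr C \<and> a \<in> Arr C \<and> f \<in> Arr C \<and>
     Dom C f' = Dom C a \<and> Cod C f' = Dom C b \<and> Cod C a = Dom C f \<and> Cod C b = Cod C f \<and>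
     Comp C f' b = Comp C a f \<and>
     Comp C f' (Restr C b) = f' \<and> Comp C a (Restr C f) = a \<and>
     (\<forall>X \<in> Obj C. \<forall>x0 \<in> Hom C X (Dom C b). \<forall>x1 \<in> Hom C X (Dom C f). \<forall>e \<in> ridem C X.
        Comp C (Comp C e x1) f = Comp C (Comp C e x0) b \<and>
        rle C e (Restr C (Comp C x1 f)) \<and> rle C e (Restr C (Comp C x0 b)) \<longrightarrow>
        (\<exists>!k. k \<in> Hom C X (Dom C f') \<and> Restr C k = e \<and>
              rle C (Comp C k f') x0 \<and> rle C (Comp C k a) x1 \<and>
              Comp C k (Restr C f') = k \<and> Comp C k (Restr C a) = k))"

section \<open>Latent hyperfibrations\<close>

text \<open>A semifunctor is given by its object part \<open>po\<close> and its arrow part \<open>pa\<close>.\<close>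

locale restriction_semifunctor =
  E: restriction_category E + B: restriction_category B
  for E :: "('o, 'm) rcat" and B :: "('p, 'n) rcat" +
  fixes po :: "'o \<Rightarrow> 'p" and pa :: "'m \<Rightarrow> 'n"
  assumes map_Obj: "X \<in> Obj E \<Longrightarrow> po X \<in> Obj B"
    and map_Hom: "f \<in> Hom E X Y \<Longrightarrow> pa f \<in> Hom B (po X) (po Y)"
    and map_Comp: "\<lbrakk>f \<in> Hom E X Y; g \<in> Hom E Y Z\<rbrakk> \<Longrightarrow> pa (f \<cdot>\<^bsub>E\<^esub> g) = pa f \<cdot>\<^bsub>B\<^esub> pa g"
    and map_Restr: "f \<in> Hom E X Y \<Longrightarrow> pa (\<rho>\<^bsub>E\<^esub> f) = \<rho>\<^bsub>B\<^esub> (pa f)"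

definition prone ::
    "('o, 'm) rcat \<Rightarrow> ('p, 'n) rcat \<Rightarrow> ('o \<Rightarrow> 'p) \<Rightarrow> ('m \<Rightarrow> 'n) \<Rightarrow> 'm \<Rightarrow> bool" where
  "prone E B po pa f' \<longleftrightarrow>
     f' \<in> Arr E \<and>
     (\<forall>Y \<in> Obj E. \<forall>g \<in> Hom E Y (Cod E f'). \<forall>h \<in> Hom B (po Y) (po (Dom E f')).
        precise_triangle B h (pa f') (pa g) \<longrightarrow>
        (\<exists>!k. k \<in> Hom E Y (Dom E f') \<and> pa k = h \<and> precise_triangle E k f' g))"

definition latent_fibration ::
    "('o, 'm) rcat \<Rightarrow> ('p, 'n) rcat \<Rightarrow> ('o \<Rightarrow> 'p) \<Rightarrow> ('m \<Rightarrow> 'n) \<Rightarrow> bool" where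
  "latent_fibration E B po pa \<longleftrightarrow>
     restriction_semifunctor E B po pa \<and>
     (\<forall>X \<in> Obj E. \<forall>f \<in> Arr B. Cod B f = po X \<and> f = f \<cdot>\<^bsub>B\<^esub> pa (Id E X) \<longrightarrow>
        (\<exists>f'. prone E B po pa f' \<and> Cod E f' = X \<and> pa f' = f))"

text \<open>Restriction idempotents on an object form a meet-semilattice whose meet is composition;
  the isomorphism below is one of semilattices.\<close>

definition hyperconnected ::
    "('o, 'm) rcat \<Rightarrow> ('p, 'n) rcat \<Rightarrow> ('o \<Rightarrow> 'p) \<Rightarrow> ('m \<Rightarrow> 'n) \<Rightarrow> bool" where
  "hyperconnected E B po pa \<longleftrightarrow>
     (\<forall>X \<in> Obj E.
        bij_betw pa (ridem E X) {d \<in> ridem B (po X). d \<cdot>\<^bsub>B\<^esub> pa (Id E X) = d} \<and>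
        (\<forall>e \<in> ridem E X. \<forall>e' \<in> ridem E X. pa (e \<cdot>\<^bsub>E\<^esub> e') = pa e \<cdot>\<^bsub>B\<^esub> pa e'))"

definition latent_hyperfibration ::
    "('o, 'm) rcat \<Rightarrow> ('p, 'n) rcat \<Rightarrow> ('o \<Rightarrow> 'p) \<Rightarrow> ('m \<Rightarrow> 'n) \<Rightarrow> bool" where
  "latent_hyperfibration E B po pa \<longleftrightarrow>
     latent_fibration E B po pa \<and> hyperconnected E B po pa"

section \<open>The fibrational dual\<close>

definition subvertical ::
    "('o, 'm) rcat \<Rightarrow> ('p, 'n) rcat \<Rightarrow> ('o \<Rightarrow> 'p) \<Rightarrow> ('m \<Rightarrow> 'n) \<Rightarrow> 'm \<Rightarrow> bool" where
  "subvertical E B po pa v \<longleftrightarrow> v \<in> Arr E \<and> pa v \<in> ridem B (po (Dom E v))"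

definition dual_spans ::
    "('o, 'm) rcat \<Rightarrow> ('p, 'n) rcat \<Rightarrow> ('o \<Rightarrow> 'p) \<Rightarrow> ('m \<Rightarrow> 'n) \<Rightarrow> ('m \<times> 'm) set" where
  "dual_spans E B po pa =
     {(v, c). subvertical E B po pa v \<and> prone E B po pa c \<and>
              Dom E v = Dom E c \<and> \<rho>\<^bsub>E\<^esub> v = \<rho>\<^bsub>E\<^esub> c}"

text \<open>The witness \<open>\<beta>\<close> is the partial inverse of \<open>\<alpha>\<close>, which is unique.  Related spans have the
  same feet, because \<open>\<alpha> \<cdot> v' = v\<close> and \<open>\<alpha> \<cdot> c' = c\<close>.\<close>

definition dual_equiv ::
    "('o, 'm) rcat \<Rightarrow> ('p, 'n) rcat \<Rightarrow> ('o \<Rightarrow> 'p) \<Rightarrow> ('m \<Rightarrow> 'n) \<Rightarrow> (('m \<times> 'm) \<times> ('m \<times> 'm)) set"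
  where
  "dual_equiv E B po pa =
     {((v, c), (v', c')).
        (v, c) \<in> dual_spans E B po pa \<and> (v', c') \<in> dual_spans E B po pa \<and>
        (\<exists>\<alpha> \<beta>. \<alpha> \<in> Hom E (Dom E v) (Dom E v') \<and>
               subvertical E B po pa \<alpha> \<and> partial_inverse E \<alpha> \<beta> \<and>
               \<alpha> \<cdot>\<^bsub>E\<^esub> v' = v \<and> \<alpha> \<cdot>\<^bsub>E\<^esub> c' = c \<and>
               \<beta> \<cdot>\<^bsub>E\<^esub> v = v' \<and> \<beta> \<cdot>\<^bsub>E\<^esub> c = c' \<and>
               \<rho>\<^bsub>E\<^esub> \<alpha> = \<rho>\<^bsub>E\<^esub> c \<and> \<rho>\<^bsub>E\<^esub> \<beta> = \<rho>\<^bsub>E\<^esub> c')}"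

definition dual_class ::
    "('o, 'm) rcat \<Rightarrow> ('p, 'n) rcat \<Rightarrow> ('o \<Rightarrow> 'p) \<Rightarrow> ('m \<Rightarrow> 'n) \<Rightarrow> 'm \<Rightarrow> 'm \<Rightarrow> ('m \<times> 'm) set" where
  "dual_class E B po pa v c = dual_equiv E B po pa `` {(v, c)}"

definition hat ::
    "('o, 'm) rcat \<Rightarrow> ('p, 'n) rcat \<Rightarrow> ('o \<Rightarrow> 'p) \<Rightarrow> ('m \<Rightarrow> 'n) \<Rightarrow> 'm \<Rightarrow> 'm" where
  "hat E B po pa v = (THE e. e \<in> ridem E (Cod E v) \<and> pa e = pa v)"

text \<open>The map from \<open>X\<close> to \<open>Y\<close> represented by the span \<open>(v, c)\<close> has domain the codomain of \<open>v\<close> and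
  codomain the codomain of \<open>c\<close>.  Composition and restriction are unions over all choices of
  representatives (and of latent pullback); such a union is a single class exactly because
  the class obtained does not depend on the choices.\<close>

definition fib_dual ::
    "('o, 'm) rcat \<Rightarrow> ('p, 'n) rcat \<Rightarrow> ('o \<Rightarrow> 'p) \<Rightarrow> ('m \<Rightarrow> 'n) \<Rightarrow> ('o, ('m \<times> 'm) set) rcat" where
  "fib_dual E B po pa =
     \<lparr>Obj = Obj E,
      Arr = dual_spans E B po pa // dual_equiv E B po pa,
      Dom = (\<lambda>F. the_elem ((\<lambda>(v, c). Cod E v) ` F)),
      Cod = (\<lambda>F. the_elem ((\<lambda>(v, c). Cod E c) ` F)),
      Id = (\<lambda>X. dual_class E B po pa (Id E X) (Id E X)),
      Comp = (\<lambda>F G. \<Union> {dual_class E B po pa (v2' \<cdot>\<^bsub>E\<^esub> v1) (c1' \<cdot>\<^bsub>E\<^esub> c2) | v1 c1 v2 c2 v2' c1'.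
                (v1, c1) \<in> F \<and> (v2, c2) \<in> G \<and> latent_pullback E c1' v2 v2' c1 \<and>
                subvertical E B po pa v2' \<and> prone E B po pa c1'}),
      Restr = (\<lambda>F. \<Union> {dual_class E B po pa (hat E B po pa v) (hat E B po pa v) | v c.
                (v, c) \<in> F})\<rparr>"

definition dual_map :: "('m \<Rightarrow> 'n) \<Rightarrow> ('m \<times> 'm) set \<Rightarrow> 'n" where
  "dual_map pa F = the_elem ((\<lambda>(v, c). pa c) ` F)"

end

theory Submission
  imports Defs
begin

text \<open>A span \<open>(v, c)\<close> is determined up to equivalence by its action, the relation
  \<open>{(k v, k c) | k \<rho>(c) = k}\<close> on the maps of \<open>E\<close>.  The action turns composition of the dual into
  composition of relations, because a latent pullback describes exactly the pairs that can be
  chained, and restriction into a partial identity cut out by a condition in \<open>B\<close>.  The axioms of a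
  restriction category therefore hold in the dual because they hold for relations and in \<open>B\<close>.  The
  prone lift of \<open>f\<close> to the dual is \<open>[(\<rho>(c), c)]\<close> for \<open>c\<close> a prone lift of \<open>f\<close> to \<open>E\<close>: a map \<open>[(v, d)]\<close>
  factors through it by factoring \<open>d\<close> through \<open>c\<close>.\<close>

text \<open>The action recovers a span in the manner of the Yoneda lemma: it contains the span's own
  pair of legs, so equal actions give comparison maps in both directions, and proneness forces these
  to be partial inverses. The obstacle is partiality: each factorisation carries a side condition
  \<open>k \<cdot> \<rho> f = k\<close>, that k lands in the domain of f. Hyperconnectedness makes
  such a condition in E equivalent to its image in B, which is why domains of definition in the dual
  can be described by conditions on \<open>pa x\<close> alone. As identities need not be preserved,
  the idempotents \<open>pa (Id E X)\<close> stay visible, and only maps absorbing them have lifts.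
  That the unions defining composition and restriction are single classes is derived along the way:
  the action of the result does not depend on the choices made.\<close>

context restriction_category
begin

section \<open>Calculus of domains of definition in a restriction category\<close>

lemma Hom_iff: "f \<in> Hom C X Y \<longleftrightarrow> f \<in> Arr C \<and> Dom C f = X \<and> Cod C f = Y"
  by (auto simp: Hom_def)

lemma arr_comp [simp]:
  assumes "f \<in> Arr C" "g \<in> Arr C" "Cod C f = Dom C g"
  shows "f \<cdot> g \<in> Arr C" "Dom C (f \<cdot> g) = Dom C f" "Cod C (f \<cdot> g) = Cod C g"
  using Comp_Hom[of f "Dom C f" "Cod C f" g "Cod C g"] assms by (auto simp: Hom_iff)

lemma arr_restr [simp]:
  assumes "f \<in> Arr C"
  shows "\<rho> f \<in> Arr C" "Dom C (\<rho> f) = Dom C f" "Cod C (\<rho> f) = Dom C f"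
  using Restr_Hom[of f "Dom C f" "Cod C f"] assms by (auto simp: Hom_iff)

lemma arr_id [simp]:
  assumes "X \<in> Obj C"
  shows "Id C X \<in> Arr C" "Dom C (Id C X) = X" "Cod C (Id C X) = X"
  using Id_Hom[of X] assms by (auto simp: Hom_iff)

lemma id_comp [simp]: "f \<in> Arr C \<Longrightarrow> Dom C f = X \<Longrightarrow> Id C X \<cdot> f = f"
  by (metis Hom_iff Id_left)

lemma comp_id [simp]: "f \<in> Arr C \<Longrightarrow> Cod C f = X \<Longrightarrow> f \<cdot> Id C X = f"
  by (metis Hom_iff Id_right)

lemma assoc:
  "\<lbrakk>f \<in> Arr C; g \<in> Arr C; h \<in> Arr C; Cod C f = Dom C g; Cod C g = Dom C h\<rbrakk>
    \<Longrightarrow> (f \<cdot> g) \<cdot> h = f \<cdot> (g \<cdot> h)"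
  by (metis Hom_iff Comp_assoc)

lemma restr_comp_self [simp]: "f \<in> Arr C \<Longrightarrow> \<rho> f \<cdot> f = f"
  by (metis Hom_iff R1)

lemma restr_commute:
  "\<lbrakk>f \<in> Arr C; g \<in> Arr C; Dom C f = Dom C g\<rbrakk> \<Longrightarrow> \<rho> f \<cdot> \<rho> g = \<rho> g \<cdot> \<rho> f"
  by (metis Hom_iff R2)

lemma restr_restr_comp:
  "\<lbrakk>f \<in> Arr C; g \<in> Arr C; Dom C f = Dom C g\<rbrakk> \<Longrightarrow> \<rho> (\<rho> f \<cdot> g) = \<rho> f \<cdot> \<rho> g"
  by (metis Hom_iff R3)

lemma comp_restr:
  "\<lbrakk>f \<in> Arr C; g \<in> Arr C; Cod C f = Dom C g\<rbrakk> \<Longrightarrow> f \<cdot> \<rho> g = \<rho> (f \<cdot> g) \<cdot> f"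
  by (metis Hom_iff R4)

lemma restr_id [simp]: "X \<in> Obj C \<Longrightarrow> \<rho> (Id C X) = Id C X"
  using restr_comp_self[of "Id C X"] comp_id[of "\<rho> (Id C X)" X] by simp

lemma restr_restr [simp]: "f \<in> Arr C \<Longrightarrow> \<rho> (\<rho> f) = \<rho> f"
  using restr_restr_comp[of f "Id C (Dom C f)"] by (simp add: Dom_Obj)

lemma restr_idem [simp]: "f \<in> Arr C \<Longrightarrow> \<rho> f \<cdot> \<rho> f = \<rho> f"
  using restr_restr_comp[of f f] by simp

lemma restr_comp_restr_comp:
  "\<lbrakk>f \<in> Arr C; g \<in> Arr C; Cod C f = Dom C g\<rbrakk> \<Longrightarrow> \<rho> f \<cdot> \<rho> (f \<cdot> g) = \<rho> (f \<cdot> g)"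
  using restr_restr_comp[of f "f \<cdot> g"] assoc[of "\<rho> f" f g] by simp

lemma restr_comp_restr:
  assumes "f \<in> Arr C" "g \<in> Arr C" "Cod C f = Dom C g"
  shows "\<rho> (f \<cdot> \<rho> g) = \<rho> (f \<cdot> g)"
  using assms comp_restr[of f g] restr_restr_comp[of "f \<cdot> g" f]
    restr_comp_restr_comp[of f g] restr_commute[of f "f \<cdot> g"]
  by simp

text \<open>R.4 turns \<open>f \<cdot> \<rho> g\<close> into
  \<open>\<rho> (f \<cdot> g) \<cdot> f\<close>, which gives one direction; taking restrictions
  gives the other. The left side, read as "f lands in the domain of g", is the form of preciseness
  used from here on, because it survives precomposition.\<close>

lemma comp_restr_eq_iff:
  assumes "f \<in> Arr C" "g \<in> Arr C" "Cod C f = Dom C g"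
  shows "f \<cdot> \<rho> g = f \<longleftrightarrow> \<rho> (f \<cdot> g) = \<rho> f"
  by (metis assms comp_restr restr_comp_restr restr_comp_self)

lemma precise_triangle_iff:
  "precise_triangle C k f g \<longleftrightarrow>
     k \<in> Arr C \<and> f \<in> Arr C \<and> Cod C k = Dom C f \<and> k \<cdot> f = g \<and> k \<cdot> \<rho> f = k"
  by (auto simp: precise_triangle_def comp_restr_eq_iff)

lemma ridem_iff: "e \<in> ridem C X \<longleftrightarrow> e \<in> Arr C \<and> Dom C e = X \<and> Cod C e = X \<and> \<rho> e = e"
  by (auto simp: ridem_def Hom_iff)

lemma restr_ridem: "f \<in> Arr C \<Longrightarrow> \<rho> f \<in> ridem C (Dom C f)"
  by (simp add: ridem_iff)

text \<open>With \<open>k \<cdot> \<rho> f = k\<close> read as "k lands in the domain of f", this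
  lemma and the next two split landing in the domain of \<open>f \<cdot> g\<close> into two stages:
  k lands in the domain of f, and \<open>k \<cdot> f\<close> in that of g.\<close>

lemma comp_restr_comp:
  assumes "k \<in> Arr C" "f \<in> Arr C" "g \<in> Arr C" "Cod C k = Dom C f" "Cod C f = Dom C g"
    and "k \<cdot> \<rho> f = k" "(k \<cdot> f) \<cdot> \<rho> g = k \<cdot> f"
  shows "k \<cdot> \<rho> (f \<cdot> g) = k"
  using assms comp_restr_eq_iff[of k f] comp_restr_eq_iff[of "k \<cdot> f" g]
    comp_restr_eq_iff[of k "f \<cdot> g"] assoc[of k f g]
  by simp

lemma comp_restr_comp_left:
  assumes "k \<in> Arr C" "f \<in> Arr C" "g \<in> Arr C" "Cod C k = Dom C f" "Cod C f = Dom C g"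
    and "k \<cdot> \<rho> (f \<cdot> g) = k"
  shows "k \<cdot> \<rho> f = k"
proof -
  have "k \<cdot> \<rho> f = k \<cdot> (\<rho> (f \<cdot> g) \<cdot> \<rho> f)"
    using assms assoc[of k "\<rho> (f \<cdot> g)" "\<rho> f"] by simp
  also have "\<dots> = k"
    using assms restr_commute[of f "f \<cdot> g"] restr_comp_restr_comp[of f g] by simp
  finally show ?thesis .
qed

lemma comp_restr_comp_right:
  assumes "k \<in> Arr C" "f \<in> Arr C" "g \<in> Arr C" "Cod C k = Dom C f" "Cod C f = Dom C g"
    and "k \<cdot> \<rho> (f \<cdot> g) = k"
  shows "(k \<cdot> f) \<cdot> \<rho> g = k \<cdot> f"
proof -
  have "(k \<cdot> f) \<cdot> \<rho> g = (k \<cdot> \<rho> (f \<cdot> g)) \<cdot> f"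
    using assms(1-5) assoc[of k f "\<rho> g"] assoc[of k "\<rho> (f \<cdot> g)" f] comp_restr[of f g] by simp
  then show ?thesis using assms(6) by simp
qed

text \<open>By R.3 each inequality makes the restriction of the smaller map the product of both
  restrictions. That product is symmetric by R.2, so the restrictions agree.\<close>

lemma le_antisym:
  assumes "f \<in> Arr C" "g \<in> Arr C" "Dom C f = Dom C g" "\<rho> f \<cdot> g = f" "\<rho> g \<cdot> f = g"
  shows "f = g"
proof -
  have "\<rho> f = \<rho> f \<cdot> \<rho> g"
    using restr_restr_comp[OF assms(1-3)] unfolding assms(4) .
  also have "\<dots> = \<rho> g \<cdot> \<rho> f"
    by (rule restr_commute[OF assms(1-3)])
  also have "\<dots> = \<rho> g"
    using restr_restr_comp[OF assms(2,1) assms(3)[symmetric]] unfolding assms(5) by (rule sym)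
  finally have "\<rho> f \<cdot> g = \<rho> g \<cdot> g" by (rule arg_cong)
  then show ?thesis unfolding assms(4) restr_comp_self[OF assms(2)] .
qed

end

section \<open>Images under a restriction semifunctor\<close>

context restriction_semifunctor
begin

lemma pa_arr [simp]:
  assumes "f \<in> Arr E"
  shows "pa f \<in> Arr B" "Dom B (pa f) = po (Dom E f)" "Cod B (pa f) = po (Cod E f)"
  using map_Hom[of f "Dom E f" "Cod E f"] assms by (auto simp: E.Hom_iff B.Hom_iff)

lemma pa_comp [simp]:
  "\<lbrakk>f \<in> Arr E; g \<in> Arr E; Cod E f = Dom E g\<rbrakk> \<Longrightarrow> pa (f \<cdot>\<^bsub>E\<^esub> g) = pa f \<cdot>\<^bsub>B\<^esub> pa g"
  using map_Comp[of f "Dom E f" "Cod E f" g "Cod E g"] by (simp add: E.Hom_iff)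

lemma pa_restr [simp]: "f \<in> Arr E \<Longrightarrow> pa (\<rho>\<^bsub>E\<^esub> f) = \<rho>\<^bsub>B\<^esub> (pa f)"
  using map_Restr[of f "Dom E f" "Cod E f"] by (simp add: E.Hom_iff)

lemma pa_comp_id: "f \<in> Arr E \<Longrightarrow> Cod E f = X \<Longrightarrow> pa f \<cdot>\<^bsub>B\<^esub> pa (Id E X) = pa f"
  using pa_comp[of f "Id E X"] E.Cod_Obj[of f] by (auto simp del: pa_comp)

lemma pa_ridem: "e \<in> ridem E X \<Longrightarrow> pa e \<in> ridem B (po X)"
  using pa_restr[of e] by (auto simp: E.ridem_iff B.ridem_iff)

end

section \<open>Hyperconnectedness as reflection of restrictions from B to E\<close>

locale hyperfibration =
  restriction_semifunctor E B po pa
  for E :: "('o, 'm) rcat" and B :: "('p, 'n) rcat"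
    and po :: "'o \<Rightarrow> 'p" and pa :: "'m \<Rightarrow> 'n" +
  assumes prone_over: "\<lbrakk>X \<in> Obj E; f \<in> Arr B; Cod B f = po X; f = f \<cdot>\<^bsub>B\<^esub> pa (Id E X)\<rbrakk>
      \<Longrightarrow> \<exists>f'. prone E B po pa f' \<and> Cod E f' = X \<and> pa f' = f"
    and hyperconnected: "hyperconnected E B po pa"
begin

abbreviation "Prone \<equiv> prone E B po pa"
abbreviation "Spans \<equiv> dual_spans E B po pa"

lemma bij_betw_ridem:
  "X \<in> Obj E \<Longrightarrow> bij_betw pa (ridem E X) {d \<in> ridem B (po X). d \<cdot>\<^bsub>B\<^esub> pa (Id E X) = d}"
  using hyperconnected by (simp add: hyperconnected_def)

lemma ridem_inject:
  assumes "d \<in> ridem E X" "e \<in> ridem E X" "pa d = pa e"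
  shows "d = e"
proof -
  have "X \<in> Obj E" using assms(1) E.Dom_Obj[of d] unfolding E.ridem_iff by blast
  then show ?thesis
    using inj_onD[OF bij_betw_imp_inj_on[OF bij_betw_ridem]] assms by blast
qed

lemma ridem_over:
  assumes "X \<in> Obj E" "d \<in> ridem B (po X)" "d \<cdot>\<^bsub>B\<^esub> pa (Id E X) = d"
  obtains e where "e \<in> ridem E X" "pa e = d"
proof -
  have "d \<in> pa ` ridem E X"
    unfolding bij_betw_imp_surj_on[OF bij_betw_ridem[OF assms(1)]] using assms by simp
  then show ?thesis using that by blast
qed

text \<open>Both restrictions are idempotents on one object, where \<open>pa\<close> is
  injective.\<close>

lemma restr_reflect:
  assumes "f \<in> Arr E" "g \<in> Arr E" "Dom E f = Dom E g" "\<rho>\<^bsub>B\<^esub> (pa f) = \<rho>\<^bsub>B\<^esub> (pa g)"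
  shows "\<rho>\<^bsub>E\<^esub> f = \<rho>\<^bsub>E\<^esub> g"
  using assms E.restr_ridem[of f] E.restr_ridem[of g] by (intro ridem_inject) auto

text \<open>Landing in a domain is an equation between restrictions by
  \<open>comp_restr_eq_iff\<close>, and such equations are reflected. Preciseness of a triangle in E
  can thus always be checked in B.\<close>

lemma comp_restr_reflect:
  assumes "k \<in> Arr E" "f \<in> Arr E" "Cod E k = Dom E f"
  shows "k \<cdot>\<^bsub>E\<^esub> \<rho>\<^bsub>E\<^esub> f = k \<longleftrightarrow> pa k \<cdot>\<^bsub>B\<^esub> \<rho>\<^bsub>B\<^esub> (pa f) = pa k"
proof
  assume "k \<cdot>\<^bsub>E\<^esub> \<rho>\<^bsub>E\<^esub> f = k"
  then have "pa (k \<cdot>\<^bsub>E\<^esub> \<rho>\<^bsub>E\<^esub> f) = pa k" by simp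
  then show "pa k \<cdot>\<^bsub>B\<^esub> \<rho>\<^bsub>B\<^esub> (pa f) = pa k" using assms by simp
next
  assume "pa k \<cdot>\<^bsub>B\<^esub> \<rho>\<^bsub>B\<^esub> (pa f) = pa k"
  then show "k \<cdot>\<^bsub>E\<^esub> \<rho>\<^bsub>E\<^esub> f = k"
    using assms restr_reflect[of "k \<cdot>\<^bsub>E\<^esub> f" k]
    by (simp add: E.comp_restr_eq_iff B.comp_restr_eq_iff)
qed

section \<open>Prone maps: lifting, cancellation and closure properties\<close>

lemma Prone_arr: "Prone c \<Longrightarrow> c \<in> Arr E"
  by (simp add: prone_def)

lemma Prone_ex1:
  assumes "Prone c" "y \<in> Arr E" "Cod E y = Cod E c"
    and "g \<in> Arr B" "Dom B g = po (Dom E y)" "Cod B g = po (Dom E c)"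
    and "g \<cdot>\<^bsub>B\<^esub> pa c = pa y" "g \<cdot>\<^bsub>B\<^esub> \<rho>\<^bsub>B\<^esub> (pa c) = g"
  shows "\<exists>!k. k \<in> Hom E (Dom E y) (Dom E c) \<and> pa k = g \<and> precise_triangle E k c y"
proof -
  have "precise_triangle B g (pa c) (pa y)"
    using assms Prone_arr[of c] by (simp add: B.precise_triangle_iff)
  moreover have "y \<in> Hom E (Dom E y) (Cod E c)" "g \<in> Hom B (po (Dom E y)) (po (Dom E c))"
    using assms by (simp_all add: E.Hom_iff B.Hom_iff)
  ultimately show ?thesis using assms(1) E.Dom_Obj[OF assms(2)] by (simp add: prone_def)
qed

lemma Prone_lift:
  assumes "Prone c" "y \<in> Arr E" "Cod E y = Cod E c"
    and "g \<in> Arr B" "Dom B g = po (Dom E y)" "Cod B g = po (Dom E c)"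
    and "g \<cdot>\<^bsub>B\<^esub> pa c = pa y" "g \<cdot>\<^bsub>B\<^esub> \<rho>\<^bsub>B\<^esub> (pa c) = g"
  obtains k where "k \<in> Arr E" "Dom E k = Dom E y" "Cod E k = Dom E c" "pa k = g"
    "k \<cdot>\<^bsub>E\<^esub> c = y" "k \<cdot>\<^bsub>E\<^esub> \<rho>\<^bsub>E\<^esub> c = k"
  using Prone_ex1[OF assms] that by (auto simp: E.Hom_iff E.precise_triangle_iff)

text \<open>Uniqueness of lifts as a cancellation law. Preciseness is required in B only, and for k
  only: since \<open>pa k = pa l\<close>, \<open>comp_restr_reflect\<close> yields it in E for
  both.\<close>

lemma Prone_cancel:
  assumes "Prone c" "k \<in> Arr E" "l \<in> Arr E" "Cod E k = Dom E c" "Cod E l = Dom E c"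
    and "Dom E k = Dom E l" "k \<cdot>\<^bsub>E\<^esub> c = l \<cdot>\<^bsub>E\<^esub> c" "pa k = pa l"
    and "pa k \<cdot>\<^bsub>B\<^esub> \<rho>\<^bsub>B\<^esub> (pa c) = pa k"
  shows "k = l"
proof -
  have c: "c \<in> Arr E" using assms(1) by (rule Prone_arr)
  let ?P = "\<lambda>j. j \<in> Hom E (Dom E k) (Dom E c) \<and> pa j = pa k \<and> precise_triangle E j c (k \<cdot>\<^bsub>E\<^esub> c)"
  have "\<exists>!j. ?P j"
    using Prone_ex1[OF assms(1), of "k \<cdot>\<^bsub>E\<^esub> c" "pa k"] assms c by simp
  moreover have "?P k" "?P l"
    using assms c comp_restr_reflect[of k c] comp_restr_reflect[of l c]
    by (simp_all add: E.Hom_iff E.precise_triangle_iff)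
  ultimately show ?thesis by blast
qed

text \<open>The lift is not asked to be precise: it lies over the precise g, and
  \<open>comp_restr_reflect\<close> carries preciseness up to E.\<close>

lemma ProneI:
  assumes "c \<in> Arr E"
    and lift: "\<And>y g. \<lbrakk>y \<in> Arr E; Cod E y = Cod E c; g \<in> Arr B; Dom B g = po (Dom E y);
        Cod B g = po (Dom E c); g \<cdot>\<^bsub>B\<^esub> pa c = pa y; g \<cdot>\<^bsub>B\<^esub> \<rho>\<^bsub>B\<^esub> (pa c) = g\<rbrakk>
      \<Longrightarrow> \<exists>k. k \<in> Arr E \<and> Dom E k = Dom E y \<and> Cod E k = Dom E c \<and> pa k = g \<and> k \<cdot>\<^bsub>E\<^esub> c = y"
    and cancel: "\<And>k l. \<lbrakk>k \<in> Arr E; l \<in> Arr E; Cod E k = Dom E c; Cod E l = Dom E c;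
        Dom E k = Dom E l; k \<cdot>\<^bsub>E\<^esub> c = l \<cdot>\<^bsub>E\<^esub> c; pa k = pa l; pa k \<cdot>\<^bsub>B\<^esub> \<rho>\<^bsub>B\<^esub> (pa c) = pa k\<rbrakk>
      \<Longrightarrow> k = l"
  shows "Prone c"
  unfolding prone_def
proof (intro conjI ballI impI)
  fix Y y g
  assume y: "y \<in> Hom E Y (Cod E c)" and g: "g \<in> Hom B (po Y) (po (Dom E c))"
    and t: "precise_triangle B g (pa c) (pa y)"
  obtain k where k: "k \<in> Arr E" "Dom E k = Y" "Cod E k = Dom E c" "pa k = g" "k \<cdot>\<^bsub>E\<^esub> c = y"
    using lift[of y g] y g t by (auto simp: E.Hom_iff B.Hom_iff B.precise_triangle_iff)
  have g': "g \<cdot>\<^bsub>B\<^esub> \<rho>\<^bsub>B\<^esub> (pa c) = g" using t by (simp add: B.precise_triangle_iff)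
  show "\<exists>!k. k \<in> Hom E Y (Dom E c) \<and> pa k = g \<and> precise_triangle E k c y"
  proof (rule ex1I[of _ k])
    show "k \<in> Hom E Y (Dom E c) \<and> pa k = g \<and> precise_triangle E k c y"
      using k g' assms(1) comp_restr_reflect[of k c] by (simp add: E.Hom_iff E.precise_triangle_iff)
    fix l assume "l \<in> Hom E Y (Dom E c) \<and> pa l = g \<and> precise_triangle E l c y"
    then show "l = k" using cancel[of l k] k g' by (simp add: E.Hom_iff E.precise_triangle_iff)
  qed
qed (fact assms(1))

text \<open>The lift is built backwards: y lifts through d over \<open>g \<cdot> pa c\<close>, and
  the result lifts through c over g. Uniqueness cancels in the same order, d before c. The fact
  \<open>B\<close> splits preciseness against the composite into what each stage needs.\<close>

lemma Prone_comp:
  assumes "Prone c" "Prone d" "Cod E c = Dom E d"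
  shows "Prone (c \<cdot>\<^bsub>E\<^esub> d)"
proof (rule ProneI)
  have cd: "c \<in> Arr E" "d \<in> Arr E" using assms by (simp_all add: Prone_arr)
  note cd = cd assms(3)
  show "c \<cdot>\<^bsub>E\<^esub> d \<in> Arr E" using cd by simp
  have B: "g \<cdot>\<^bsub>B\<^esub> \<rho>\<^bsub>B\<^esub> (pa c) = g \<and> (g \<cdot>\<^bsub>B\<^esub> pa c) \<cdot>\<^bsub>B\<^esub> \<rho>\<^bsub>B\<^esub> (pa d) = g \<cdot>\<^bsub>B\<^esub> pa c"
    if "g \<in> Arr B" "Cod B g = po (Dom E c)" "g \<cdot>\<^bsub>B\<^esub> \<rho>\<^bsub>B\<^esub> (pa (c \<cdot>\<^bsub>E\<^esub> d)) = g" for g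
  proof -
    have "g \<cdot>\<^bsub>B\<^esub> \<rho>\<^bsub>B\<^esub> (pa c \<cdot>\<^bsub>B\<^esub> pa d) = g" using that(3) cd by simp
    then show ?thesis
      using that(1,2) cd
      by (intro conjI B.comp_restr_comp_left[of g "pa c" "pa d"]
          B.comp_restr_comp_right[of g "pa c" "pa d"]) simp_all
  qed
  { fix y g
    assume y: "y \<in> Arr E" "Cod E y = Cod E (c \<cdot>\<^bsub>E\<^esub> d)"
      and g: "g \<in> Arr B" "Dom B g = po (Dom E y)" "Cod B g = po (Dom E (c \<cdot>\<^bsub>E\<^esub> d))"
        "g \<cdot>\<^bsub>B\<^esub> pa (c \<cdot>\<^bsub>E\<^esub> d) = pa y" "g \<cdot>\<^bsub>B\<^esub> \<rho>\<^bsub>B\<^esub> (pa (c \<cdot>\<^bsub>E\<^esub> d)) = g"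
    have g': "Cod B g = po (Dom E c)" using g(3) cd by simp
    have y': "Cod E y = Cod E d" using y(2) cd by simp
    have gy: "(g \<cdot>\<^bsub>B\<^esub> pa c) \<cdot>\<^bsub>B\<^esub> pa d = pa y" using g(1,4) g' cd by (simp add: B.assoc)
    have gc: "g \<cdot>\<^bsub>B\<^esub> \<rho>\<^bsub>B\<^esub> (pa c) = g" "(g \<cdot>\<^bsub>B\<^esub> pa c) \<cdot>\<^bsub>B\<^esub> \<rho>\<^bsub>B\<^esub> (pa d) = g \<cdot>\<^bsub>B\<^esub> pa c"
      using B[OF g(1) g' g(5)] by blast+
    obtain l where l: "l \<in> Arr E" "Dom E l = Dom E y" "Cod E l = Dom E d"
        "pa l = g \<cdot>\<^bsub>B\<^esub> pa c" "l \<cdot>\<^bsub>E\<^esub> d = y"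
      by (rule Prone_lift[OF assms(2) y(1) y' _ _ _ gy gc(2)]) (use g(1,2) g' cd in simp_all)
    obtain k where k: "k \<in> Arr E" "Dom E k = Dom E l" "Cod E k = Dom E c" "pa k = g" "k \<cdot>\<^bsub>E\<^esub> c = l"
      by (rule Prone_lift[OF assms(1) l(1) _ g(1) _ g' l(4)[symmetric] gc(1)]) (use l(2,3) g(2) cd in simp_all)
    show "\<exists>k. k \<in> Arr E \<and> Dom E k = Dom E y \<and> Cod E k = Dom E (c \<cdot>\<^bsub>E\<^esub> d) \<and> pa k = g
        \<and> k \<cdot>\<^bsub>E\<^esub> (c \<cdot>\<^bsub>E\<^esub> d) = y"
      using k l cd E.assoc[of k c d] by (intro exI[of _ k]) simp }
  fix k l
  assume k: "k \<in> Arr E" "Cod E k = Dom E (c \<cdot>\<^bsub>E\<^esub> d)"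
    and l: "l \<in> Arr E" "Cod E l = Dom E (c \<cdot>\<^bsub>E\<^esub> d)"
    and kl: "Dom E k = Dom E l" "k \<cdot>\<^bsub>E\<^esub> (c \<cdot>\<^bsub>E\<^esub> d) = l \<cdot>\<^bsub>E\<^esub> (c \<cdot>\<^bsub>E\<^esub> d)" "pa k = pa l"
    and kr: "pa k \<cdot>\<^bsub>B\<^esub> \<rho>\<^bsub>B\<^esub> (pa (c \<cdot>\<^bsub>E\<^esub> d)) = pa k"
  have cod: "Cod E k = Dom E c" "Cod E l = Dom E c" using k(2) l(2) cd by simp_all
  have pk: "pa k \<cdot>\<^bsub>B\<^esub> \<rho>\<^bsub>B\<^esub> (pa c) = pa k"
    "(pa k \<cdot>\<^bsub>B\<^esub> pa c) \<cdot>\<^bsub>B\<^esub> \<rho>\<^bsub>B\<^esub> (pa d) = pa k \<cdot>\<^bsub>B\<^esub> pa c"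
    using B[of "pa k"] k(1) cod kr by simp_all
  have "k \<cdot>\<^bsub>E\<^esub> c = l \<cdot>\<^bsub>E\<^esub> c"
  proof (rule Prone_cancel[OF assms(2)])
    show "(k \<cdot>\<^bsub>E\<^esub> c) \<cdot>\<^bsub>E\<^esub> d = (l \<cdot>\<^bsub>E\<^esub> c) \<cdot>\<^bsub>E\<^esub> d"
      using kl(2) k(1) l(1) cod cd by (simp add: E.assoc)
  qed (use k(1) l(1) cod cd kl(1,3) pk(2) in simp_all)
  then show "k = l"
    by (rule Prone_cancel[OF assms(1) k(1) l(1) cod kl(1) _ kl(3) pk(1)])
qed

text \<open>In place of y, the map \<open>y \<cdot> c\<close> is lifted through
  \<open>d \<cdot> c\<close>, and c is cancelled afterwards. As d lands in the domain of c, the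
  images of d and \<open>d \<cdot> c\<close> have the same restriction, so the same g are precise
  against both.\<close>

lemma Prone_factor:
  assumes "Prone (d \<cdot>\<^bsub>E\<^esub> c)" "Prone c" "d \<in> Arr E" "Cod E d = Dom E c" "d \<cdot>\<^bsub>E\<^esub> \<rho>\<^bsub>E\<^esub> c = d"
  shows "Prone d"
proof (rule ProneI)
  have c: "c \<in> Arr E" using assms(2) by (rule Prone_arr)
  note cd = c assms(3,4)
  have dc: "pa d \<cdot>\<^bsub>B\<^esub> \<rho>\<^bsub>B\<^esub> (pa c) = pa d"
    using comp_restr_reflect[of d c] cd assms(5) by blast
  then have "\<rho>\<^bsub>B\<^esub> (pa d \<cdot>\<^bsub>B\<^esub> pa c) = \<rho>\<^bsub>B\<^esub> (pa d)"
    using B.comp_restr_eq_iff[of "pa d" "pa c"] cd by simp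
  then have dc': "\<rho>\<^bsub>B\<^esub> (pa (d \<cdot>\<^bsub>E\<^esub> c)) = \<rho>\<^bsub>B\<^esub> (pa d)" using cd by simp
  { fix y g
    assume y: "y \<in> Arr E" "Cod E y = Cod E d"
      and g: "g \<in> Arr B" "Dom B g = po (Dom E y)" "Cod B g = po (Dom E d)"
      and gd: "g \<cdot>\<^bsub>B\<^esub> pa d = pa y" and gr: "g \<cdot>\<^bsub>B\<^esub> \<rho>\<^bsub>B\<^esub> (pa d) = g"
    have gdc: "g \<cdot>\<^bsub>B\<^esub> pa (d \<cdot>\<^bsub>E\<^esub> c) = pa (y \<cdot>\<^bsub>E\<^esub> c)"
      using g y cd by (simp add: B.assoc[symmetric] gd)
    have yc: "pa y \<cdot>\<^bsub>B\<^esub> \<rho>\<^bsub>B\<^esub> (pa c) = pa y"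
      unfolding gd[symmetric] using g cd by (simp add: B.assoc dc)
    have gr': "g \<cdot>\<^bsub>B\<^esub> \<rho>\<^bsub>B\<^esub> (pa (d \<cdot>\<^bsub>E\<^esub> c)) = g" unfolding dc' by (fact gr)
    obtain k where k: "k \<in> Arr E" "Dom E k = Dom E (y \<cdot>\<^bsub>E\<^esub> c)" "Cod E k = Dom E (d \<cdot>\<^bsub>E\<^esub> c)"
        "pa k = g" and kdc: "k \<cdot>\<^bsub>E\<^esub> (d \<cdot>\<^bsub>E\<^esub> c) = y \<cdot>\<^bsub>E\<^esub> c"
      by (rule Prone_lift[OF assms(1) _ _ g(1) _ _ gdc gr']) (use y g(2,3) cd in simp_all)
    have k': "Dom E k = Dom E y" "Cod E k = Dom E d" using k(2,3) y cd by simp_all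
    have "k \<cdot>\<^bsub>E\<^esub> d = y"
    proof (rule Prone_cancel[OF assms(2)])
      show "(k \<cdot>\<^bsub>E\<^esub> d) \<cdot>\<^bsub>E\<^esub> c = y \<cdot>\<^bsub>E\<^esub> c" using k(1) k' cd kdc by (simp add: E.assoc)
      show p: "pa (k \<cdot>\<^bsub>E\<^esub> d) = pa y" using k(1,4) k' cd gd by simp
      show "pa (k \<cdot>\<^bsub>E\<^esub> d) \<cdot>\<^bsub>B\<^esub> \<rho>\<^bsub>B\<^esub> (pa c) = pa (k \<cdot>\<^bsub>E\<^esub> d)" unfolding p by (fact yc)
    qed (use k(1) k' y cd in simp_all)
    then show "\<exists>k. k \<in> Arr E \<and> Dom E k = Dom E y \<and> Cod E k = Dom E d \<and> pa k = g \<and> k \<cdot>\<^bsub>E\<^esub> d = y"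
      using k(1,4) k' by blast }
  fix k l
  assume k: "k \<in> Arr E" "l \<in> Arr E" "Cod E k = Dom E d" "Cod E l = Dom E d"
    and kl: "Dom E k = Dom E l" "k \<cdot>\<^bsub>E\<^esub> d = l \<cdot>\<^bsub>E\<^esub> d" "pa k = pa l"
    and kr: "pa k \<cdot>\<^bsub>B\<^esub> \<rho>\<^bsub>B\<^esub> (pa d) = pa k"
  show "k = l"
  proof (rule Prone_cancel[OF assms(1) k(1,2) _ _ kl(1) _ kl(3)])
    show "k \<cdot>\<^bsub>E\<^esub> (d \<cdot>\<^bsub>E\<^esub> c) = l \<cdot>\<^bsub>E\<^esub> (d \<cdot>\<^bsub>E\<^esub> c)"
      using E.assoc[of k d c] E.assoc[of l d c] k cd kl(2) by simp
    show "pa k \<cdot>\<^bsub>B\<^esub> \<rho>\<^bsub>B\<^esub> (pa (d \<cdot>\<^bsub>E\<^esub> c)) = pa k" unfolding dc' by (fact kr)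
  qed (use k cd in simp_all)
qed (fact assms(3))

text \<open>A precise g absorbs the idempotent \<open>pa e\<close>, so
  \<open>pa y = g \<cdot> pa e = g\<close> and y is its own lift.\<close>

lemma Prone_ridem:
  assumes "e \<in> ridem E X"
  shows "Prone e"
proof (rule ProneI)
  have e: "e \<in> Arr E" "Dom E e = X" "Cod E e = X" "\<rho>\<^bsub>E\<^esub> e = e" using assms by (auto simp: E.ridem_iff)
  have pe: "\<rho>\<^bsub>B\<^esub> (pa e) = pa e" using pa_restr[of e] e by simp
  show "e \<in> Arr E" by fact
  { fix y g
    assume y: "y \<in> Arr E" "Cod E y = Cod E e" "g \<cdot>\<^bsub>B\<^esub> pa e = pa y" "g \<cdot>\<^bsub>B\<^esub> \<rho>\<^bsub>B\<^esub> (pa e) = g"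
    then have "pa y = g" "y \<cdot>\<^bsub>E\<^esub> e = y"
      using pe e comp_restr_reflect[of y e] by auto
    then show "\<exists>k. k \<in> Arr E \<and> Dom E k = Dom E y \<and> Cod E k = Dom E e \<and> pa k = g \<and> k \<cdot>\<^bsub>E\<^esub> e = y"
      using y e by auto }
  fix k l
  assume "k \<in> Arr E" "l \<in> Arr E" "Cod E k = Dom E e" "Cod E l = Dom E e"
    "k \<cdot>\<^bsub>E\<^esub> e = l \<cdot>\<^bsub>E\<^esub> e" "pa k = pa l" "pa k \<cdot>\<^bsub>B\<^esub> \<rho>\<^bsub>B\<^esub> (pa e) = pa k"
  then show "k = l" using e comp_restr_reflect[of k e] comp_restr_reflect[of l e] by simp
qed

section \<open>Spans, their actions and span equivalence\<close>

lemma subvertical_iff: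
  "subvertical E B po pa v \<longleftrightarrow> v \<in> Arr E \<and> po (Cod E v) = po (Dom E v) \<and> \<rho>\<^bsub>B\<^esub> (pa v) = pa v"
  by (auto simp: subvertical_def B.ridem_iff)

text \<open>For subvertical v, \<open>pa v = \<rho> (pa v) = pa (\<rho> v)\<close>. Comparing the
  restrictions of v and c therefore becomes, by reflection, the last equation on the right, which
  also contains the idempotence of \<open>pa v\<close>.\<close>

lemma Spans_iff:
  "(v, c) \<in> Spans \<longleftrightarrow> Prone c \<and> v \<in> Arr E \<and> Dom E v = Dom E c \<and> po (Cod E v) = po (Dom E c)
     \<and> pa v = \<rho>\<^bsub>B\<^esub> (pa c)" (is "?L \<longleftrightarrow> ?R")
proof
  assume ?L
  then have v: "v \<in> Arr E" "po (Cod E v) = po (Dom E v)" "\<rho>\<^bsub>B\<^esub> (pa v) = pa v"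
    and c: "Prone c" "Dom E v = Dom E c" "\<rho>\<^bsub>E\<^esub> v = \<rho>\<^bsub>E\<^esub> c"
    by (simp_all add: dual_spans_def subvertical_iff)
  have "pa v = pa (\<rho>\<^bsub>E\<^esub> v)" using pa_restr[OF v(1)] v(3) by (rule trans[symmetric])
  also have "\<dots> = \<rho>\<^bsub>B\<^esub> (pa c)" unfolding c(3) by (rule pa_restr[OF Prone_arr[OF c(1)]])
  finally show ?R using v(1,2) c(1,2) by simp
next
  assume R: ?R
  then have c: "c \<in> Arr E" by (simp add: Prone_arr)
  have "\<rho>\<^bsub>B\<^esub> (pa v) = \<rho>\<^bsub>B\<^esub> (\<rho>\<^bsub>B\<^esub> (pa c))" using R by simp
  then have rv: "\<rho>\<^bsub>B\<^esub> (pa v) = \<rho>\<^bsub>B\<^esub> (pa c)" using c by simp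
  then have "\<rho>\<^bsub>E\<^esub> v = \<rho>\<^bsub>E\<^esub> c" using R c by (intro restr_reflect) simp_all
  moreover have "\<rho>\<^bsub>B\<^esub> (pa v) = pa v" using rv R by metis
  ultimately show ?L using R unfolding dual_spans_def subvertical_iff by simp
qed

lemma SpansD:
  assumes "(v, c) \<in> Spans"
  shows "Prone c" "c \<in> Arr E" "v \<in> Arr E" "Dom E v = Dom E c" "po (Cod E v) = po (Dom E c)"
    "pa v = \<rho>\<^bsub>B\<^esub> (pa c)" "\<rho>\<^bsub>E\<^esub> v = \<rho>\<^bsub>E\<^esub> c"
proof -
  show "\<rho>\<^bsub>E\<^esub> v = \<rho>\<^bsub>E\<^esub> c" using assms by (simp add: dual_spans_def)
  show "Prone c" "v \<in> Arr E" "Dom E v = Dom E c" "po (Cod E v) = po (Dom E c)" "pa v = \<rho>\<^bsub>B\<^esub> (pa c)"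
    using assms unfolding Spans_iff by blast+
  then show "c \<in> Arr E" by (intro Prone_arr)
qed

text \<open>The maps k play the part of generalised points of the apex, and the condition on k keeps
  them in the common domain of the two legs.\<close>

definition span_action :: "'m \<Rightarrow> 'm \<Rightarrow> ('m \<times> 'm) set" where
  "span_action v c = {(k \<cdot>\<^bsub>E\<^esub> v, k \<cdot>\<^bsub>E\<^esub> c) | k. k \<in> Arr E \<and> Cod E k = Dom E c \<and> k \<cdot>\<^bsub>E\<^esub> \<rho>\<^bsub>E\<^esub> c = k}"

text \<open>The point k lies over \<open>pa x\<close> because \<open>pa v\<close> is the restriction
  of \<open>pa c\<close>, which \<open>pa k\<close> absorbs. Composing with v thus loses nothing
  over B.\<close>

lemma span_actionE:
  assumes "(v, c) \<in> Spans" "(x, y) \<in> span_action v c"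
  obtains k where "k \<in> Arr E" "Cod E k = Dom E c" "k \<cdot>\<^bsub>E\<^esub> \<rho>\<^bsub>E\<^esub> c = k"
    "x = k \<cdot>\<^bsub>E\<^esub> v" "y = k \<cdot>\<^bsub>E\<^esub> c" "Dom E k = Dom E x" "pa k = pa x"
proof -
  note vc = SpansD[OF assms(1)]
  obtain k where k: "k \<in> Arr E" "Cod E k = Dom E c" "k \<cdot>\<^bsub>E\<^esub> \<rho>\<^bsub>E\<^esub> c = k"
    and xy: "x = k \<cdot>\<^bsub>E\<^esub> v" "y = k \<cdot>\<^bsub>E\<^esub> c"
    using assms(2) by (auto simp: span_action_def)
  have "pa x = pa k \<cdot>\<^bsub>B\<^esub> \<rho>\<^bsub>B\<^esub> (pa c)" unfolding xy using k(1,2) vc(3,4,6) by simp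
  also have "\<dots> = pa k" using comp_restr_reflect[of k c] k vc(2) by blast
  finally have "pa k = pa x" ..
  moreover have "Dom E k = Dom E x" unfolding xy using k(1,2) vc(3,4) by simp
  ultimately show ?thesis using that k xy by blast
qed

lemma span_actionD:
  assumes "(v, c) \<in> Spans" "(x, y) \<in> span_action v c"
  shows "x \<in> Arr E" "y \<in> Arr E" "Dom E x = Dom E y" "Cod E x = Cod E v" "Cod E y = Cod E c"
    "pa x \<cdot>\<^bsub>B\<^esub> pa c = pa y" "pa x \<cdot>\<^bsub>B\<^esub> \<rho>\<^bsub>B\<^esub> (pa c) = pa x"
proof -
  note vc = SpansD[OF assms(1)]
  from assms obtain k where k: "k \<in> Arr E" "Cod E k = Dom E c" "k \<cdot>\<^bsub>E\<^esub> \<rho>\<^bsub>E\<^esub> c = k"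
    and xy: "x = k \<cdot>\<^bsub>E\<^esub> v" "y = k \<cdot>\<^bsub>E\<^esub> c" and kx: "pa k = pa x"
    by (rule span_actionE)
  show "x \<in> Arr E" "y \<in> Arr E" "Dom E x = Dom E y" "Cod E x = Cod E v" "Cod E y = Cod E c"
    unfolding xy using k(1,2) vc(2-4) by simp_all
  show "pa x \<cdot>\<^bsub>B\<^esub> pa c = pa y" unfolding kx[symmetric] xy(2) using k(1,2) vc(2) by simp
  show "pa x \<cdot>\<^bsub>B\<^esub> \<rho>\<^bsub>B\<^esub> (pa c) = pa x"
    unfolding kx[symmetric] using comp_restr_reflect[of k c] k vc(2) by blast
qed

text \<open>The generic point is \<open>k = \<rho> c\<close>, which fixes both legs since they share
  their restriction.\<close>

lemma span_action_self:
  assumes "(v, c) \<in> Spans"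
  shows "(v, c) \<in> span_action v c"
proof -
  note vc = SpansD[OF assms]
  have "\<rho>\<^bsub>E\<^esub> c \<cdot>\<^bsub>E\<^esub> v = v" using E.restr_comp_self[OF vc(3)] vc(7) by simp
  moreover have "\<rho>\<^bsub>E\<^esub> c \<cdot>\<^bsub>E\<^esub> c = c" "\<rho>\<^bsub>E\<^esub> c \<in> Arr E" "Cod E (\<rho>\<^bsub>E\<^esub> c) = Dom E c"
    "\<rho>\<^bsub>E\<^esub> c \<cdot>\<^bsub>E\<^esub> \<rho>\<^bsub>E\<^esub> c = \<rho>\<^bsub>E\<^esub> c"
    using vc(2) by simp_all
  ultimately show ?thesis unfolding span_action_def by force
qed

text \<open>Points are moved along \<alpha>, from k to \<open>k \<cdot> \<alpha>\<close>. The new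
  point lands in the domain of c' because \<alpha> and c have the same restriction.\<close>

lemma span_action_subset:
  assumes "(v, c) \<in> Spans" "(v', c') \<in> Spans"
    and a: "\<alpha> \<in> Arr E" "Dom E \<alpha> = Dom E c" "Cod E \<alpha> = Dom E c'"
      "\<alpha> \<cdot>\<^bsub>E\<^esub> v' = v" "\<alpha> \<cdot>\<^bsub>E\<^esub> c' = c" "\<rho>\<^bsub>E\<^esub> \<alpha> = \<rho>\<^bsub>E\<^esub> c"
  shows "span_action v c \<subseteq> span_action v' c'"
proof
  fix z assume "z \<in> span_action v c"
  then obtain k where k: "k \<in> Arr E" "Cod E k = Dom E c" "k \<cdot>\<^bsub>E\<^esub> \<rho>\<^bsub>E\<^esub> c = k"
    and z: "z = (k \<cdot>\<^bsub>E\<^esub> v, k \<cdot>\<^bsub>E\<^esub> c)"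
    unfolding span_action_def by blast
  note vc = SpansD[OF assms(1)] and vc' = SpansD[OF assms(2)]
  have ka: "k \<cdot>\<^bsub>E\<^esub> \<alpha> \<in> Arr E" "Cod E (k \<cdot>\<^bsub>E\<^esub> \<alpha>) = Dom E c'" using k(1,2) a(1-3) by simp_all
  have z': "z = ((k \<cdot>\<^bsub>E\<^esub> \<alpha>) \<cdot>\<^bsub>E\<^esub> v', (k \<cdot>\<^bsub>E\<^esub> \<alpha>) \<cdot>\<^bsub>E\<^esub> c')"
    unfolding z a(4,5)[symmetric] using k(1,2) a(1-3) vc'(2-4) by (simp add: E.assoc)
  have "(k \<cdot>\<^bsub>E\<^esub> \<alpha>) \<cdot>\<^bsub>E\<^esub> c' = k \<cdot>\<^bsub>E\<^esub> c" using z z' by simp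
  moreover have "\<rho>\<^bsub>E\<^esub> (k \<cdot>\<^bsub>E\<^esub> \<alpha>) = \<rho>\<^bsub>E\<^esub> (k \<cdot>\<^bsub>E\<^esub> \<rho>\<^bsub>E\<^esub> \<alpha>)"
    using E.restr_comp_restr[of k \<alpha>] k(1,2) a(1,2) by simp
  moreover have "\<rho>\<^bsub>E\<^esub> (k \<cdot>\<^bsub>E\<^esub> c) = \<rho>\<^bsub>E\<^esub> (k \<cdot>\<^bsub>E\<^esub> \<rho>\<^bsub>E\<^esub> c)"
    using E.restr_comp_restr[of k c] k(1,2) vc(2) by simp
  ultimately have "\<rho>\<^bsub>E\<^esub> ((k \<cdot>\<^bsub>E\<^esub> \<alpha>) \<cdot>\<^bsub>E\<^esub> c') = \<rho>\<^bsub>E\<^esub> (k \<cdot>\<^bsub>E\<^esub> \<alpha>)" using a(6) by simp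
  then have "(k \<cdot>\<^bsub>E\<^esub> \<alpha>) \<cdot>\<^bsub>E\<^esub> \<rho>\<^bsub>E\<^esub> c' = k \<cdot>\<^bsub>E\<^esub> \<alpha>"
    using E.comp_restr_eq_iff[OF ka(1) vc'(2) ka(2)] by simp
  then show "z \<in> span_action v' c'" unfolding span_action_def using ka z' by blast
qed

text \<open>The legs of each span form a pair in the action of the other. Over B this says
  \<open>\<rho> (pa c) \<cdot> pa c' = pa c\<close> and the same with the roles exchanged, so the
  two images are below each other.\<close>

lemma span_action_eq_pa:
  assumes "(v, c) \<in> Spans" "(v', c') \<in> Spans" "span_action v c = span_action v' c'"
  shows "Cod E v = Cod E v'" "Cod E c = Cod E c'" "pa c = pa c'"
proof -
  have 1: "(v, c) \<in> span_action v' c'" and 2: "(v', c') \<in> span_action v c"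
    using span_action_self assms by blast+
  note vc = SpansD[OF assms(1)] and vc' = SpansD[OF assms(2)]
  show "Cod E v = Cod E v'" "Cod E c = Cod E c'"
    using span_actionD(4,5)[OF assms(2) 1] by simp_all
  then have "po (Dom E c) = po (Dom E c')" using vc(5) vc'(5) by simp
  then have "Dom B (pa c) = Dom B (pa c')" using vc(2) vc'(2) by simp
  moreover have "\<rho>\<^bsub>B\<^esub> (pa c) \<cdot>\<^bsub>B\<^esub> pa c' = pa c" "\<rho>\<^bsub>B\<^esub> (pa c') \<cdot>\<^bsub>B\<^esub> pa c = pa c'"
    using span_actionD(6)[OF assms(2) 1] span_actionD(6)[OF assms(1) 2] unfolding vc(6) vc'(6) .
  ultimately show "pa c = pa c'"
    by (rule B.le_antisym[OF pa_arr(1)[OF vc(2)] pa_arr(1)[OF vc'(2)]])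
qed

text \<open>The mediator \<alpha> is the point of the second apex that witnesses membership of the
  pair (v, c) in the second action.\<close>

lemma span_action_mediator:
  assumes "(v, c) \<in> Spans" "(v', c') \<in> Spans" "span_action v c = span_action v' c'"
  obtains \<alpha> where "\<alpha> \<in> Arr E" "Dom E \<alpha> = Dom E c" "Cod E \<alpha> = Dom E c'"
    "\<alpha> \<cdot>\<^bsub>E\<^esub> v' = v" "\<alpha> \<cdot>\<^bsub>E\<^esub> c' = c" "pa \<alpha> = pa v" "\<rho>\<^bsub>E\<^esub> \<alpha> = \<rho>\<^bsub>E\<^esub> c"
proof -
  note vc = SpansD[OF assms(1)]
  have "(v, c) \<in> span_action v' c'" using span_action_self assms by blast
  with assms(2) obtain \<alpha> where a: "\<alpha> \<in> Arr E" "Cod E \<alpha> = Dom E c'" "v = \<alpha> \<cdot>\<^bsub>E\<^esub> v'"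
    "c = \<alpha> \<cdot>\<^bsub>E\<^esub> c'" "Dom E \<alpha> = Dom E v" "pa \<alpha> = pa v" by (rule span_actionE)
  have "\<rho>\<^bsub>E\<^esub> \<alpha> = \<rho>\<^bsub>E\<^esub> v" using a(1,5,6) vc(3) by (intro restr_reflect) simp_all
  then show ?thesis
    using that[OF a(1) _ a(2) a(3,4)[symmetric] a(6)] a(5) vc(4,7) by simp
qed

text \<open>Both \<open>\<alpha> \<cdot> \<beta>\<close> and \<open>\<rho> c\<close> factor c
  through itself over \<open>\<rho> (pa c)\<close>, so proneness of c identifies them.\<close>

lemma span_action_mediator_inverse:
  assumes "(v, c) \<in> Spans" "(v', c') \<in> Spans" "span_action v c = span_action v' c'"
    and a: "\<alpha> \<in> Arr E" "Dom E \<alpha> = Dom E c" "Cod E \<alpha> = Dom E c'" "\<alpha> \<cdot>\<^bsub>E\<^esub> c' = c" "pa \<alpha> = pa v"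
    and b: "\<beta> \<in> Arr E" "Dom E \<beta> = Dom E c'" "Cod E \<beta> = Dom E c" "\<beta> \<cdot>\<^bsub>E\<^esub> c = c'" "pa \<beta> = pa v'"
  shows "\<alpha> \<cdot>\<^bsub>E\<^esub> \<beta> = \<rho>\<^bsub>E\<^esub> c"
proof -
  note vc = SpansD[OF assms(1)] and vc' = SpansD[OF assms(2)]
  have "pa (\<alpha> \<cdot>\<^bsub>E\<^esub> \<beta>) = \<rho>\<^bsub>B\<^esub> (pa c) \<cdot>\<^bsub>B\<^esub> \<rho>\<^bsub>B\<^esub> (pa c')" using a(1,3,5) b(1,2,5) vc(6) vc'(6) by simp
  also have "\<dots> = \<rho>\<^bsub>B\<^esub> (pa c)" unfolding span_action_eq_pa(3)[OF assms(1-3)] using vc'(2) by simp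
  finally have p: "pa (\<alpha> \<cdot>\<^bsub>E\<^esub> \<beta>) = \<rho>\<^bsub>B\<^esub> (pa c)" .
  show ?thesis
  proof (rule Prone_cancel[OF vc(1)])
    have "(\<alpha> \<cdot>\<^bsub>E\<^esub> \<beta>) \<cdot>\<^bsub>E\<^esub> c = c" using a(1-4) b(1-4) vc(2) by (simp add: E.assoc)
    then show "(\<alpha> \<cdot>\<^bsub>E\<^esub> \<beta>) \<cdot>\<^bsub>E\<^esub> c = \<rho>\<^bsub>E\<^esub> c \<cdot>\<^bsub>E\<^esub> c" using vc(2) by simp
    show "pa (\<alpha> \<cdot>\<^bsub>E\<^esub> \<beta>) = pa (\<rho>\<^bsub>E\<^esub> c)" using p vc(2) by simp
    show "pa (\<alpha> \<cdot>\<^bsub>E\<^esub> \<beta>) \<cdot>\<^bsub>B\<^esub> \<rho>\<^bsub>B\<^esub> (pa c) = pa (\<alpha> \<cdot>\<^bsub>E\<^esub> \<beta>)" unfolding p using vc(2) by simp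
  qed (use a(1-3) b(1-3) vc(2) in simp_all)
qed

lemma dual_equiv_iff:
  "((v, c), (v', c')) \<in> dual_equiv E B po pa \<longleftrightarrow>
     (v, c) \<in> Spans \<and> (v', c') \<in> Spans \<and> span_action v c = span_action v' c'" (is "?L \<longleftrightarrow> ?R")
proof
  assume ?L
  then obtain \<alpha> \<beta> where s: "(v, c) \<in> Spans" "(v', c') \<in> Spans"
    and a: "\<alpha> \<in> Hom E (Dom E v) (Dom E v')" "\<alpha> \<cdot>\<^bsub>E\<^esub> v' = v" "\<alpha> \<cdot>\<^bsub>E\<^esub> c' = c" "\<rho>\<^bsub>E\<^esub> \<alpha> = \<rho>\<^bsub>E\<^esub> c"
    and b: "partial_inverse E \<alpha> \<beta>" "\<beta> \<cdot>\<^bsub>E\<^esub> v = v'" "\<beta> \<cdot>\<^bsub>E\<^esub> c = c'" "\<rho>\<^bsub>E\<^esub> \<beta> = \<rho>\<^bsub>E\<^esub> c'"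
    unfolding dual_equiv_def by blast
  note vc = SpansD[OF s(1)] and vc' = SpansD[OF s(2)]
  have a1: "\<alpha> \<in> Arr E" "Dom E \<alpha> = Dom E c" "Cod E \<alpha> = Dom E c'"
    using a(1) vc(4) vc'(4) by (simp_all add: E.Hom_iff)
  have b1: "\<beta> \<in> Arr E" "Dom E \<beta> = Dom E c'" "Cod E \<beta> = Dom E c"
    using b(1) a1 by (simp_all add: partial_inverse_def E.Hom_iff)
  show ?R
    using s span_action_subset[OF s a1 a(2-4)] span_action_subset[OF s(2,1) b1 b(2-4)] by blast
next
  assume ?R
  then have s: "(v, c) \<in> Spans" "(v', c') \<in> Spans" and eq: "span_action v c = span_action v' c'"
    by simp_all
  note vc = SpansD[OF s(1)] and vc' = SpansD[OF s(2)]
  obtain \<alpha> where a: "\<alpha> \<in> Arr E" "Dom E \<alpha> = Dom E c" "Cod E \<alpha> = Dom E c'"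
    "\<alpha> \<cdot>\<^bsub>E\<^esub> v' = v" "\<alpha> \<cdot>\<^bsub>E\<^esub> c' = c" "pa \<alpha> = pa v" "\<rho>\<^bsub>E\<^esub> \<alpha> = \<rho>\<^bsub>E\<^esub> c"
    using s eq by (rule span_action_mediator)
  obtain \<beta> where b: "\<beta> \<in> Arr E" "Dom E \<beta> = Dom E c'" "Cod E \<beta> = Dom E c"
    "\<beta> \<cdot>\<^bsub>E\<^esub> v = v'" "\<beta> \<cdot>\<^bsub>E\<^esub> c = c'" "pa \<beta> = pa v'" "\<rho>\<^bsub>E\<^esub> \<beta> = \<rho>\<^bsub>E\<^esub> c'"
    using s(2,1) eq[symmetric] by (rule span_action_mediator)
  have ab: "\<alpha> \<cdot>\<^bsub>E\<^esub> \<beta> = \<rho>\<^bsub>E\<^esub> c"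
    by (rule span_action_mediator_inverse[OF s eq a(1-3,5,6) b(1-3,5,6)])
  have ba: "\<beta> \<cdot>\<^bsub>E\<^esub> \<alpha> = \<rho>\<^bsub>E\<^esub> c'"
    by (rule span_action_mediator_inverse[OF s(2,1) eq[symmetric] b(1-3,5,6) a(1-3,5,6)])
  have "partial_inverse E \<alpha> \<beta>"
    using a(1-3,7) b(1-3,7) ab ba by (simp add: partial_inverse_def E.Hom_iff)
  moreover have "subvertical E B po pa \<alpha>"
    using a(1-3,6) vc(2,5,6) vc'(5) span_action_eq_pa(1)[OF s eq] by (simp add: subvertical_iff)
  moreover have "\<alpha> \<in> Hom E (Dom E v) (Dom E v')" using a(1-3) vc(4) vc'(4) by (simp add: E.Hom_iff)
  ultimately show ?L unfolding dual_equiv_def using s a(4,5,7) b(4,5,7) by blast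
qed

section \<open>Latent pullbacks and composition of spans\<close>

lemma latent_pullback_square:
  assumes "latent_pullback E c1' v2 v2' c1"
  shows "c1' \<in> Arr E" "v2 \<in> Arr E" "v2' \<in> Arr E" "c1 \<in> Arr E" "Dom E v2' = Dom E c1'"
    "Cod E c1' = Dom E v2" "Cod E v2' = Dom E c1" "Cod E v2 = Cod E c1"
    "c1' \<cdot>\<^bsub>E\<^esub> v2 = v2' \<cdot>\<^bsub>E\<^esub> c1" "c1' \<cdot>\<^bsub>E\<^esub> \<rho>\<^bsub>E\<^esub> v2 = c1'" "v2' \<cdot>\<^bsub>E\<^esub> \<rho>\<^bsub>E\<^esub> c1 = v2'"
    "\<rho>\<^bsub>E\<^esub> v2' = \<rho>\<^bsub>E\<^esub> c1'"
proof -
  note p = assms[unfolded latent_pullback_def]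
  show *: "c1' \<in> Arr E" "v2 \<in> Arr E" "v2' \<in> Arr E" "c1 \<in> Arr E" "Dom E v2' = Dom E c1'"
    "Cod E c1' = Dom E v2" "Cod E v2' = Dom E c1" "Cod E v2 = Cod E c1"
    "c1' \<cdot>\<^bsub>E\<^esub> v2 = v2' \<cdot>\<^bsub>E\<^esub> c1" "c1' \<cdot>\<^bsub>E\<^esub> \<rho>\<^bsub>E\<^esub> v2 = c1'" "v2' \<cdot>\<^bsub>E\<^esub> \<rho>\<^bsub>E\<^esub> c1 = v2'"
    using p by simp_all
  \<comment> \<open>Each leg lands in the domain of the map after it, so each has the restriction of
    the common diagonal.\<close>
  show "\<rho>\<^bsub>E\<^esub> v2' = \<rho>\<^bsub>E\<^esub> c1'"
    using E.comp_restr_eq_iff[of c1' v2] E.comp_restr_eq_iff[of v2' c1] * by simp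
qed

text \<open>When k and l land in the domains of c1 and v2, both have the restriction of the common
  composite. Taking this restriction as the idempotent e of the universal property turns its
  inequalities into equalities.\<close>

lemma latent_pullback_mediator:
  assumes "latent_pullback E c1' v2 v2' c1"
    and k: "k \<in> Arr E" "Cod E k = Dom E c1" "k \<cdot>\<^bsub>E\<^esub> \<rho>\<^bsub>E\<^esub> c1 = k"
    and l: "l \<in> Arr E" "Cod E l = Dom E v2" "l \<cdot>\<^bsub>E\<^esub> \<rho>\<^bsub>E\<^esub> v2 = l"
    and kl: "Dom E k = Dom E l" "k \<cdot>\<^bsub>E\<^esub> c1 = l \<cdot>\<^bsub>E\<^esub> v2"
  obtains m where "m \<in> Arr E" "Cod E m = Dom E c1'" "m \<cdot>\<^bsub>E\<^esub> c1' = l" "m \<cdot>\<^bsub>E\<^esub> v2' = k"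
    "m \<cdot>\<^bsub>E\<^esub> \<rho>\<^bsub>E\<^esub> c1' = m"
proof -
  note sq = latent_pullback_square[OF assms(1)]
  have rk: "\<rho>\<^bsub>E\<^esub> (k \<cdot>\<^bsub>E\<^esub> c1) = \<rho>\<^bsub>E\<^esub> k" using E.comp_restr_eq_iff[of k c1] k sq by blast
  have rl: "\<rho>\<^bsub>E\<^esub> (l \<cdot>\<^bsub>E\<^esub> v2) = \<rho>\<^bsub>E\<^esub> l" using E.comp_restr_eq_iff[of l v2] l sq by blast
  have r: "\<rho>\<^bsub>E\<^esub> l = \<rho>\<^bsub>E\<^esub> k" using rk rl kl(2) by simp
  have "\<exists>m. m \<in> Hom E (Dom E k) (Dom E c1') \<and> \<rho>\<^bsub>E\<^esub> m = \<rho>\<^bsub>E\<^esub> k \<and>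
              rle E (m \<cdot>\<^bsub>E\<^esub> c1') l \<and> rle E (m \<cdot>\<^bsub>E\<^esub> v2') k \<and>
              m \<cdot>\<^bsub>E\<^esub> \<rho>\<^bsub>E\<^esub> c1' = m \<and> m \<cdot>\<^bsub>E\<^esub> \<rho>\<^bsub>E\<^esub> v2' = m"
  proof -
    have "Dom E k \<in> Obj E" "l \<in> Hom E (Dom E k) (Dom E v2)" "k \<in> Hom E (Dom E k) (Dom E c1)"
      "\<rho>\<^bsub>E\<^esub> k \<in> ridem E (Dom E k)"
      using k l kl E.Dom_Obj[of k] by (simp_all add: E.Hom_iff E.ridem_iff)
    moreover have "(\<rho>\<^bsub>E\<^esub> k \<cdot>\<^bsub>E\<^esub> k) \<cdot>\<^bsub>E\<^esub> c1 = (\<rho>\<^bsub>E\<^esub> k \<cdot>\<^bsub>E\<^esub> l) \<cdot>\<^bsub>E\<^esub> v2"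
      using k l kl r by (metis E.restr_comp_self)
    moreover have "rle E (\<rho>\<^bsub>E\<^esub> k) (\<rho>\<^bsub>E\<^esub> (k \<cdot>\<^bsub>E\<^esub> c1))" "rle E (\<rho>\<^bsub>E\<^esub> k) (\<rho>\<^bsub>E\<^esub> (l \<cdot>\<^bsub>E\<^esub> v2))"
      unfolding rk rl r using k by (simp_all add: rle_def E.Hom_iff)
    ultimately show ?thesis using assms(1) unfolding latent_pullback_def by blast
  qed
  then obtain m where m: "m \<in> Arr E" "Dom E m = Dom E k" "Cod E m = Dom E c1'" "\<rho>\<^bsub>E\<^esub> m = \<rho>\<^bsub>E\<^esub> k"
    "\<rho>\<^bsub>E\<^esub> (m \<cdot>\<^bsub>E\<^esub> c1') \<cdot>\<^bsub>E\<^esub> l = m \<cdot>\<^bsub>E\<^esub> c1'" "\<rho>\<^bsub>E\<^esub> (m \<cdot>\<^bsub>E\<^esub> v2') \<cdot>\<^bsub>E\<^esub> k = m \<cdot>\<^bsub>E\<^esub> v2'"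
    "m \<cdot>\<^bsub>E\<^esub> \<rho>\<^bsub>E\<^esub> c1' = m" "m \<cdot>\<^bsub>E\<^esub> \<rho>\<^bsub>E\<^esub> v2' = m"
    by (auto simp: E.Hom_iff rle_def)
  have "\<rho>\<^bsub>E\<^esub> (m \<cdot>\<^bsub>E\<^esub> c1') = \<rho>\<^bsub>E\<^esub> l" "\<rho>\<^bsub>E\<^esub> (m \<cdot>\<^bsub>E\<^esub> v2') = \<rho>\<^bsub>E\<^esub> k"
    using E.comp_restr_eq_iff[of m c1'] E.comp_restr_eq_iff[of m v2'] m sq r by simp_all
  then have "m \<cdot>\<^bsub>E\<^esub> c1' = l" "m \<cdot>\<^bsub>E\<^esub> v2' = k" using m(5,6) k l by simp_all
  then show ?thesis using that m by blast
qed

text \<open>A point m of the pullback apex amounts to points k and l of the two apexes with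
  \<open>k \<cdot> c1 = l \<cdot> v2\<close>. This common value is the middle element of the
  relational composite.\<close>

lemma latent_pullback_span:
  assumes s1: "(v1, c1) \<in> Spans" and s2: "(v2, c2) \<in> Spans"
    and pb: "latent_pullback E c1' v2 v2' c1" "subvertical E B po pa v2'" "Prone c1'"
  shows "(v2' \<cdot>\<^bsub>E\<^esub> v1, c1' \<cdot>\<^bsub>E\<^esub> c2) \<in> Spans"
    "span_action (v2' \<cdot>\<^bsub>E\<^esub> v1) (c1' \<cdot>\<^bsub>E\<^esub> c2) = span_action v1 c1 O span_action v2 c2"
proof -
  note d1 = SpansD[OF s1] and d2 = SpansD[OF s2] and sq = latent_pullback_square[OF pb(1)]
  have sv: "po (Cod E v2') = po (Dom E v2')" "\<rho>\<^bsub>B\<^esub> (pa v2') = pa v2'"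
    using pb(2) by (simp_all add: subvertical_iff)
  \<comment> \<open>The square gives this for v2, which has the same restriction as c2. So the
    points of the composite span are those landing in the domain of c1'.\<close>
  have c: "c1' \<cdot>\<^bsub>E\<^esub> \<rho>\<^bsub>E\<^esub> c2 = c1'" using sq(10) d2(7) by simp
  have rc: "\<rho>\<^bsub>E\<^esub> (c1' \<cdot>\<^bsub>E\<^esub> c2) = \<rho>\<^bsub>E\<^esub> c1'" using E.comp_restr_eq_iff[of c1' c2] c sq d2 by simp
  have pv: "pa v2' \<cdot>\<^bsub>B\<^esub> \<rho>\<^bsub>B\<^esub> (pa c1) = pa v2'" using comp_restr_reflect[of v2' c1] sq by blast
  have "pa (v2' \<cdot>\<^bsub>E\<^esub> v1) = \<rho>\<^bsub>B\<^esub> (pa v2')" using sq d1 pv sv by simp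
  also have "\<dots> = pa (\<rho>\<^bsub>E\<^esub> (c1' \<cdot>\<^bsub>E\<^esub> c2))" unfolding rc sq(12)[symmetric] using sq(3) by (rule pa_restr[symmetric])
  also have "\<dots> = \<rho>\<^bsub>B\<^esub> (pa (c1' \<cdot>\<^bsub>E\<^esub> c2))" using sq d2 by (intro pa_restr) simp
  finally show "(v2' \<cdot>\<^bsub>E\<^esub> v1, c1' \<cdot>\<^bsub>E\<^esub> c2) \<in> Spans"
    unfolding Spans_iff using Prone_comp[OF pb(3) d2(1)] sq d1 d2 sv by simp
  show "span_action (v2' \<cdot>\<^bsub>E\<^esub> v1) (c1' \<cdot>\<^bsub>E\<^esub> c2) = span_action v1 c1 O span_action v2 c2"
  proof (intro set_eqI iffI; clarify)
    fix x z assume "(x, z) \<in> span_action (v2' \<cdot>\<^bsub>E\<^esub> v1) (c1' \<cdot>\<^bsub>E\<^esub> c2)"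
    then obtain m where m: "m \<in> Arr E" "Cod E m = Dom E c1'" "m \<cdot>\<^bsub>E\<^esub> \<rho>\<^bsub>E\<^esub> c1' = m"
      and xz: "x = m \<cdot>\<^bsub>E\<^esub> (v2' \<cdot>\<^bsub>E\<^esub> v1)" "z = m \<cdot>\<^bsub>E\<^esub> (c1' \<cdot>\<^bsub>E\<^esub> c2)"
      using sq d2 rc unfolding span_action_def by auto
    have "(m \<cdot>\<^bsub>E\<^esub> v2') \<cdot>\<^bsub>E\<^esub> \<rho>\<^bsub>E\<^esub> c1 = m \<cdot>\<^bsub>E\<^esub> v2'" "(m \<cdot>\<^bsub>E\<^esub> c1') \<cdot>\<^bsub>E\<^esub> \<rho>\<^bsub>E\<^esub> c2 = m \<cdot>\<^bsub>E\<^esub> c1'"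
      using m sq d2 c by (simp_all add: E.assoc)
    then have "((m \<cdot>\<^bsub>E\<^esub> v2') \<cdot>\<^bsub>E\<^esub> v1, (m \<cdot>\<^bsub>E\<^esub> v2') \<cdot>\<^bsub>E\<^esub> c1) \<in> span_action v1 c1"
      "((m \<cdot>\<^bsub>E\<^esub> c1') \<cdot>\<^bsub>E\<^esub> v2, (m \<cdot>\<^bsub>E\<^esub> c1') \<cdot>\<^bsub>E\<^esub> c2) \<in> span_action v2 c2"
      using m sq d1 d2 unfolding span_action_def by fastforce+
    moreover have "x = (m \<cdot>\<^bsub>E\<^esub> v2') \<cdot>\<^bsub>E\<^esub> v1" "z = (m \<cdot>\<^bsub>E\<^esub> c1') \<cdot>\<^bsub>E\<^esub> c2"
      "(m \<cdot>\<^bsub>E\<^esub> v2') \<cdot>\<^bsub>E\<^esub> c1 = (m \<cdot>\<^bsub>E\<^esub> c1') \<cdot>\<^bsub>E\<^esub> v2"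
      unfolding xz using m sq d1 d2 by (simp_all add: E.assoc)
    ultimately show "(x, z) \<in> span_action v1 c1 O span_action v2 c2" by auto
  next
    fix x y z assume xy: "(x, y) \<in> span_action v1 c1" and yz: "(y, z) \<in> span_action v2 c2"
    obtain k where k: "k \<in> Arr E" "Cod E k = Dom E c1" "k \<cdot>\<^bsub>E\<^esub> \<rho>\<^bsub>E\<^esub> c1 = k"
      "x = k \<cdot>\<^bsub>E\<^esub> v1" "y = k \<cdot>\<^bsub>E\<^esub> c1" using s1 xy by (rule span_actionE)
    obtain l where l: "l \<in> Arr E" "Cod E l = Dom E c2" "l \<cdot>\<^bsub>E\<^esub> \<rho>\<^bsub>E\<^esub> c2 = l"
      "y = l \<cdot>\<^bsub>E\<^esub> v2" "z = l \<cdot>\<^bsub>E\<^esub> c2" using s2 yz by (rule span_actionE)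
    have "Dom E (k \<cdot>\<^bsub>E\<^esub> c1) = Dom E (l \<cdot>\<^bsub>E\<^esub> v2)" using k(5) l(4) by simp
    then have kl: "Dom E k = Dom E l" using k l d1 d2 by simp
    obtain m where m: "m \<in> Arr E" "Cod E m = Dom E c1'" "m \<cdot>\<^bsub>E\<^esub> c1' = l" "m \<cdot>\<^bsub>E\<^esub> v2' = k"
      "m \<cdot>\<^bsub>E\<^esub> \<rho>\<^bsub>E\<^esub> c1' = m"
      by (rule latent_pullback_mediator[OF pb(1) k(1-3) l(1) _ _ kl]) (use k l d2 in simp_all)
    have "m \<cdot>\<^bsub>E\<^esub> \<rho>\<^bsub>E\<^esub> (c1' \<cdot>\<^bsub>E\<^esub> c2) = m" using m(5) rc by simp
    moreover have "x = m \<cdot>\<^bsub>E\<^esub> (v2' \<cdot>\<^bsub>E\<^esub> v1)" "z = m \<cdot>\<^bsub>E\<^esub> (c1' \<cdot>\<^bsub>E\<^esub> c2)"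
      unfolding k(4) l(5) m(3)[symmetric] m(4)[symmetric] using m(1,2) sq d1 d2 by (simp_all add: E.assoc)
    moreover have "Cod E m = Dom E (c1' \<cdot>\<^bsub>E\<^esub> c2)" using m sq d2 by simp
    ultimately show "(x, z) \<in> span_action (v2' \<cdot>\<^bsub>E\<^esub> v1) (c1' \<cdot>\<^bsub>E\<^esub> c2)"
      unfolding span_action_def using m(1) by blast
  qed
qed

text \<open>The leg \<open>t\<close> is a prone lift of \<open>pa c1 \<cdot> \<rho> (pa c2)\<close>, and \<open>s\<close> factors \<open>t \<cdot> v2\<close> through the prone map \<open>c1\<close>.\<close>

lemma latent_pullback_exists:
  assumes s1: "(v1, c1) \<in> Spans" and s2: "(v2, c2) \<in> Spans" and cod: "Cod E v2 = Cod E c1"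
  obtains t s where "latent_pullback E t v2 s c1" "subvertical E B po pa s" "Prone t"
    "pa t = pa c1 \<cdot>\<^bsub>B\<^esub> \<rho>\<^bsub>B\<^esub> (pa c2)"
proof -
  note d1 = SpansD[OF s1] and d2 = SpansD[OF s2]
  have po2: "po (Dom E c2) = po (Cod E c1)" using d2(5) cod by simp
  note b = pa_arr[OF d1(2)] pa_arr[OF d2(2)] po2
  \<comment> \<open>Over B, \<open>?f\<close> is \<open>pa c1\<close> cut down to where the second
    span is defined. It can be lifted to the apex of that span since v2 is subvertical, so that
    \<open>po (Dom E c2) = po (Cod E c1)\<close>.\<close>
  let ?r = "\<rho>\<^bsub>B\<^esub> (pa c2)" and ?f = "pa c1 \<cdot>\<^bsub>B\<^esub> \<rho>\<^bsub>B\<^esub> (pa c2)"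
  have f: "?f \<in> Arr B" "Dom B ?f = po (Dom E c1)" "Cod B ?f = po (Dom E c2)" using b by simp_all
  \<comment> \<open>The objects \<open>Dom E c2\<close> and \<open>Cod E c1\<close> have the same
    image but may have identities with different images. It is the factor \<open>?r\<close> that
    makes \<open>?f\<close> absorb the one required for lifting.\<close>
  have "?r \<cdot>\<^bsub>B\<^esub> pa (Id E (Dom E c2)) = ?r"
    using pa_comp_id[of "\<rho>\<^bsub>E\<^esub> c2" "Dom E c2"] d2(2) by simp
  then have fid: "?f = ?f \<cdot>\<^bsub>B\<^esub> pa (Id E (Dom E c2))"
    using b E.Dom_Obj[OF d2(2)] by (simp add: B.assoc)
  obtain t where t: "Prone t" "Cod E t = Dom E c2" "pa t = ?f"
    using prone_over[OF E.Dom_Obj[OF d2(2)] f(1,3) fid] by blast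
  have ta: "t \<in> Arr E" using t(1) by (rule Prone_arr)
  have pot: "po (Dom E t) = po (Dom E c1)" using pa_arr(2)[OF ta] t(3) f by simp
  have ptv: "pa (t \<cdot>\<^bsub>E\<^esub> v2) = ?f" using ta t d2 b by (simp add: B.assoc)
  \<comment> \<open>These two equations factor \<open>?f\<close> precisely through
    \<open>pa c1\<close> with left factor \<open>\<rho> ?f\<close>. Lifting over that idempotent
    makes s subvertical.\<close>
  have rf: "\<rho>\<^bsub>B\<^esub> ?f \<cdot>\<^bsub>B\<^esub> \<rho>\<^bsub>B\<^esub> (pa c1) = \<rho>\<^bsub>B\<^esub> ?f"
    using B.restr_comp_restr_comp[of "pa c1" ?r] B.restr_commute[of "pa c1" ?f] b by simp
  have rf2: "\<rho>\<^bsub>B\<^esub> ?f \<cdot>\<^bsub>B\<^esub> pa c1 = ?f"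
    using B.comp_restr[of "pa c1" "pa c2"] B.restr_comp_restr[of "pa c1" "pa c2"] b by simp
  have tv: "t \<cdot>\<^bsub>E\<^esub> v2 \<in> Arr E" "Dom E (t \<cdot>\<^bsub>E\<^esub> v2) = Dom E t" "Cod E (t \<cdot>\<^bsub>E\<^esub> v2) = Cod E c1"
    using ta t d2 cod by simp_all
  obtain s where s: "s \<in> Arr E" "Dom E s = Dom E t" "Cod E s = Dom E c1"
    "pa s = \<rho>\<^bsub>B\<^esub> ?f" "s \<cdot>\<^bsub>E\<^esub> c1 = t \<cdot>\<^bsub>E\<^esub> v2" "s \<cdot>\<^bsub>E\<^esub> \<rho>\<^bsub>E\<^esub> c1 = s"
    by (rule Prone_lift[OF d1(1) tv(1,3), of "\<rho>\<^bsub>B\<^esub> ?f"]) (use f pot tv(2) ptv rf rf2 in simp_all)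
  have sub: "subvertical E B po pa s" using s(1-4) pot f(1) by (simp add: subvertical_iff)
  have tr: "t \<cdot>\<^bsub>E\<^esub> \<rho>\<^bsub>E\<^esub> v2 = t"
    using comp_restr_reflect[of t c2] ta t d2 b by (simp add: B.assoc)
  have "latent_pullback E t v2 s c1"
    unfolding latent_pullback_def
  proof (intro conjI ballI impI)
    fix X x0 x1 e
    assume x0: "x0 \<in> Hom E X (Dom E v2)" and x1: "x1 \<in> Hom E X (Dom E c1)"
      and e: "e \<in> ridem E X"
      and a: "(e \<cdot>\<^bsub>E\<^esub> x1) \<cdot>\<^bsub>E\<^esub> c1 = (e \<cdot>\<^bsub>E\<^esub> x0) \<cdot>\<^bsub>E\<^esub> v2 \<and>
        rle E e (\<rho>\<^bsub>E\<^esub> (x1 \<cdot>\<^bsub>E\<^esub> c1)) \<and> rle E e (\<rho>\<^bsub>E\<^esub> (x0 \<cdot>\<^bsub>E\<^esub> v2))"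
    have x: "x0 \<in> Arr E" "Dom E x0 = X" "Cod E x0 = Dom E c2" "x1 \<in> Arr E" "Dom E x1 = X"
      "Cod E x1 = Dom E c1" "e \<in> Arr E" "Dom E e = X" "Cod E e = X" "\<rho>\<^bsub>E\<^esub> e = e"
      using x0 x1 e d2(4) by (auto simp: E.Hom_iff E.ridem_iff)
    \<comment> \<open>The mediator is built for the cut-down maps, which both have restriction e and
      make the square commute exactly. They lie below x0 and x1.\<close>
    define y0 where "y0 = e \<cdot>\<^bsub>E\<^esub> x0"
    define y1 where "y1 = e \<cdot>\<^bsub>E\<^esub> x1"
    have y: "y0 \<in> Arr E" "Dom E y0 = X" "Cod E y0 = Dom E c2" "y1 \<in> Arr E" "Dom E y1 = X"
      "Cod E y1 = Dom E c1" using x by (simp_all add: y0_def y1_def)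
    have yy: "y1 \<cdot>\<^bsub>E\<^esub> c1 = y0 \<cdot>\<^bsub>E\<^esub> v2" using a by (simp add: y0_def y1_def)
    have R: "\<rho>\<^bsub>E\<^esub> (e \<cdot>\<^bsub>E\<^esub> w) = e \<and> (e \<cdot>\<^bsub>E\<^esub> w) \<cdot>\<^bsub>E\<^esub> \<rho>\<^bsub>E\<^esub> c = e \<cdot>\<^bsub>E\<^esub> w"
      if w: "w \<in> Arr E" "Dom E w = X" "c \<in> Arr E" "Cod E w = Dom E c" "rle E e (\<rho>\<^bsub>E\<^esub> (w \<cdot>\<^bsub>E\<^esub> c))" for w c
    proof -
      have "e \<cdot>\<^bsub>E\<^esub> \<rho>\<^bsub>E\<^esub> (w \<cdot>\<^bsub>E\<^esub> c) = e" using w(5) x by (simp add: rle_def)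
      then have "e \<cdot>\<^bsub>E\<^esub> \<rho>\<^bsub>E\<^esub> w = e" "(e \<cdot>\<^bsub>E\<^esub> w) \<cdot>\<^bsub>E\<^esub> \<rho>\<^bsub>E\<^esub> c = e \<cdot>\<^bsub>E\<^esub> w"
        using E.comp_restr_comp_left[of e w c] E.comp_restr_comp_right[of e w c] w x by simp_all
      then show ?thesis using E.comp_restr_eq_iff[of e w] w x by simp
    qed
    have r1: "\<rho>\<^bsub>E\<^esub> y1 = e" "y1 \<cdot>\<^bsub>E\<^esub> \<rho>\<^bsub>E\<^esub> c1 = y1" using R[of x1 c1] a x d1 by (simp_all add: y1_def)
    have r0: "\<rho>\<^bsub>E\<^esub> y0 = e" "y0 \<cdot>\<^bsub>E\<^esub> \<rho>\<^bsub>E\<^esub> c2 = y0" using R[of x0 v2] a x d2 by (simp_all add: y0_def)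
    have p0: "pa y0 \<cdot>\<^bsub>B\<^esub> ?r = pa y0" using comp_restr_reflect[of y0 c2] r0 y d2 by blast
    have p1: "pa y1 \<cdot>\<^bsub>B\<^esub> pa c1 = pa y0"
    proof -
      have "pa (y1 \<cdot>\<^bsub>E\<^esub> c1) = pa (y0 \<cdot>\<^bsub>E\<^esub> v2)" using yy by simp
      then show ?thesis using y d1 d2 p0 by simp
    qed
    have py: "pa y1 \<cdot>\<^bsub>B\<^esub> ?f = pa y0"
      using y d1 d2 b p0 p1 by (simp add: B.assoc[symmetric])
    have pe: "\<rho>\<^bsub>B\<^esub> (pa y0) = \<rho>\<^bsub>B\<^esub> (pa y1)"
      using pa_restr[of y0] pa_restr[of y1] y r0 r1 by simp
    have pyr: "pa y1 \<cdot>\<^bsub>B\<^esub> \<rho>\<^bsub>B\<^esub> ?f = pa y1"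
      using B.comp_restr_eq_iff[of "pa y1" ?f] py pe f y by simp
    \<comment> \<open>Since k has to satisfy \<open>k \<cdot> s = y1\<close> and land in the domain
      of s, which lies over an idempotent, \<open>pa y1\<close> is the only possible image of
      k.\<close>
    obtain k where k: "k \<in> Arr E" "Dom E k = X" "Cod E k = Dom E t" "pa k = pa y1"
      "k \<cdot>\<^bsub>E\<^esub> t = y0" "k \<cdot>\<^bsub>E\<^esub> \<rho>\<^bsub>E\<^esub> t = k"
      by (rule Prone_lift[OF t(1) y(1), of "pa y1"]) (use y t py pyr pot in simp_all)
    have rs: "\<rho>\<^bsub>E\<^esub> s = \<rho>\<^bsub>E\<^esub> t"
      using E.comp_restr_eq_iff[of t v2] E.comp_restr_eq_iff[of s c1] ta t s d1 d2 tr by simp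
    have ks: "k \<cdot>\<^bsub>E\<^esub> s = y1"
    proof (rule Prone_cancel[OF d1(1)])
      have "(k \<cdot>\<^bsub>E\<^esub> s) \<cdot>\<^bsub>E\<^esub> c1 = (k \<cdot>\<^bsub>E\<^esub> t) \<cdot>\<^bsub>E\<^esub> v2"
        using k(1-3) s(1-3,5) ta t(2) d1 d2 by (simp add: E.assoc)
      then show "(k \<cdot>\<^bsub>E\<^esub> s) \<cdot>\<^bsub>E\<^esub> c1 = y1 \<cdot>\<^bsub>E\<^esub> c1" using k(5) yy by simp
      show p: "pa (k \<cdot>\<^bsub>E\<^esub> s) = pa y1" using k s pyr by simp
      show "pa (k \<cdot>\<^bsub>E\<^esub> s) \<cdot>\<^bsub>B\<^esub> \<rho>\<^bsub>B\<^esub> (pa c1) = pa (k \<cdot>\<^bsub>E\<^esub> s)"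
        unfolding p using comp_restr_reflect[of y1 c1] r1 y d1 by blast
    qed (use k s y in simp_all)
    have rk: "\<rho>\<^bsub>E\<^esub> k = e"
      using E.comp_restr_eq_iff[of k t] k r0 ta by simp
    show "\<exists>!k. k \<in> Hom E X (Dom E t) \<and> \<rho>\<^bsub>E\<^esub> k = e \<and> rle E (k \<cdot>\<^bsub>E\<^esub> t) x0 \<and> rle E (k \<cdot>\<^bsub>E\<^esub> s) x1 \<and>
      k \<cdot>\<^bsub>E\<^esub> \<rho>\<^bsub>E\<^esub> t = k \<and> k \<cdot>\<^bsub>E\<^esub> \<rho>\<^bsub>E\<^esub> s = k"
    proof (rule ex1I[of _ k])
      show "k \<in> Hom E X (Dom E t) \<and> \<rho>\<^bsub>E\<^esub> k = e \<and> rle E (k \<cdot>\<^bsub>E\<^esub> t) x0 \<and> rle E (k \<cdot>\<^bsub>E\<^esub> s) x1 \<and>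
        k \<cdot>\<^bsub>E\<^esub> \<rho>\<^bsub>E\<^esub> t = k \<and> k \<cdot>\<^bsub>E\<^esub> \<rho>\<^bsub>E\<^esub> s = k"
        unfolding k(5) ks rs rle_def r0(1) r1(1)
        using k(1-3,6) rk y x by (simp add: E.Hom_iff y0_def y1_def)
      fix l
      assume "l \<in> Hom E X (Dom E t) \<and> \<rho>\<^bsub>E\<^esub> l = e \<and> rle E (l \<cdot>\<^bsub>E\<^esub> t) x0 \<and> rle E (l \<cdot>\<^bsub>E\<^esub> s) x1 \<and>
        l \<cdot>\<^bsub>E\<^esub> \<rho>\<^bsub>E\<^esub> t = l \<and> l \<cdot>\<^bsub>E\<^esub> \<rho>\<^bsub>E\<^esub> s = l"
      then have l: "l \<in> Arr E" "Dom E l = X" "Cod E l = Dom E t" "\<rho>\<^bsub>E\<^esub> l = e"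
        "\<rho>\<^bsub>E\<^esub> (l \<cdot>\<^bsub>E\<^esub> t) \<cdot>\<^bsub>E\<^esub> x0 = l \<cdot>\<^bsub>E\<^esub> t" "\<rho>\<^bsub>E\<^esub> (l \<cdot>\<^bsub>E\<^esub> s) \<cdot>\<^bsub>E\<^esub> x1 = l \<cdot>\<^bsub>E\<^esub> s"
        "l \<cdot>\<^bsub>E\<^esub> \<rho>\<^bsub>E\<^esub> t = l" "l \<cdot>\<^bsub>E\<^esub> \<rho>\<^bsub>E\<^esub> s = l"
        by (auto simp: E.Hom_iff rle_def)
      have "\<rho>\<^bsub>E\<^esub> (l \<cdot>\<^bsub>E\<^esub> t) = e" "\<rho>\<^bsub>E\<^esub> (l \<cdot>\<^bsub>E\<^esub> s) = e"
        using E.comp_restr_eq_iff[of l t] E.comp_restr_eq_iff[of l s] l(1-4,7,8) ta s(1,2) by simp_all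
      then have lt: "l \<cdot>\<^bsub>E\<^esub> t = y0" "l \<cdot>\<^bsub>E\<^esub> s = y1" using l(5,6) by (simp_all add: y0_def y1_def)
      \<comment> \<open>The idempotent \<open>pa s\<close> is absorbed by \<open>pa l\<close>, so l
        has the image of \<open>l \<cdot> s = y1\<close>, which is that of k. This is what
        cancelling t needs.\<close>
      have "pa l \<cdot>\<^bsub>B\<^esub> \<rho>\<^bsub>B\<^esub> (pa s) = pa l" using comp_restr_reflect[of l s] l(1,3,8) s by simp
      then have "pa (l \<cdot>\<^bsub>E\<^esub> s) = pa l" using l(1,3) s f(1) by simp
      then have pl: "pa l = pa k" using lt(2) k(4) by simp
      show "l = k"
        by (rule Prone_cancel[OF t(1)])
          (use l(1-3) k lt pl pyr t(3) in simp_all)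
    qed
  qed (use ta t s d1 d2 cod tr in simp_all)
  then show ?thesis using sub t(1,3) by (rule that)
qed

section \<open>Arrows of the dual: classes, composition, restriction and identities\<close>

abbreviation "Dual \<equiv> fib_dual E B po pa"
abbreviation "span_class \<equiv> dual_class E B po pa"

lemma fib_dual_sel:
  shows "Obj Dual = Obj E"
    and "Arr Dual = Spans // dual_equiv E B po pa"
    and "Dom Dual F = the_elem ((\<lambda>(v, c). Cod E v) ` F)"
    and "Cod Dual F = the_elem ((\<lambda>(v, c). Cod E c) ` F)"
    and "Id Dual X = span_class (Id E X) (Id E X)"
    and "F \<cdot>\<^bsub>Dual\<^esub> G = \<Union> {span_class (w \<cdot>\<^bsub>E\<^esub> v1) (d \<cdot>\<^bsub>E\<^esub> c2) | v1 c1 v2 c2 w d.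
      (v1, c1) \<in> F \<and> (v2, c2) \<in> G \<and> latent_pullback E d v2 w c1 \<and>
      subvertical E B po pa w \<and> Prone d}"
    and "\<rho>\<^bsub>Dual\<^esub> F = \<Union> {span_class (hat E B po pa v) (hat E B po pa v) | v c. (v, c) \<in> F}"
  unfolding fib_dual_def rcat.simps by (rule refl)+

lemma span_class_eq:
  assumes "(v, c) \<in> Spans"
  shows "span_class v c = {(v', c'). (v', c') \<in> Spans \<and> span_action v' c' = span_action v c}"
  using assms by (auto simp: dual_class_def dual_equiv_iff)

text \<open>All members of a class share one action, so the union equals it and no representative
  has to be chosen.\<close>

definition action :: "('m \<times> 'm) set \<Rightarrow> ('m \<times> 'm) set" where
  "action F = (\<Union>(v, c)\<in>F. span_action v c)"

lemma the_elem_span_class: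
  assumes "(v, c) \<in> Spans"
    and "\<And>v' c'. \<lbrakk>(v', c') \<in> Spans; span_action v' c' = span_action v c\<rbrakk> \<Longrightarrow> h v' c' = h v c"
  shows "the_elem ((\<lambda>(v, c). h v c) ` span_class v c) = h v c"
proof -
  have "(\<lambda>(v, c). h v c) ` span_class v c = {h v c}"
  proof (intro equalityI image_subsetI)
    fix z assume "z \<in> span_class v c"
    then obtain v' c' where "z = (v', c')" "(v', c') \<in> Spans" "span_action v' c' = span_action v c"
      by (auto simp: span_class_eq[OF assms(1)])
    then show "(\<lambda>(v, c). h v c) z \<in> {h v c}" using assms(2) by simp
  next
    have "(v, c) \<in> span_class v c" using assms(1) by (simp add: span_class_eq)
    then show "{h v c} \<subseteq> (\<lambda>(v, c). h v c) ` span_class v c" by (auto intro: rev_image_eqI)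
  qed
  then show ?thesis by simp
qed

lemma span_class_arr:
  assumes "(v, c) \<in> Spans"
  shows "span_class v c \<in> Arr Dual" "Dom Dual (span_class v c) = Cod E v"
    "Cod Dual (span_class v c) = Cod E c" "dual_map pa (span_class v c) = pa c"
    "action (span_class v c) = span_action v c"
proof -
  show "span_class v c \<in> Arr Dual"
    using quotientI[OF assms] by (simp add: fib_dual_sel(2) dual_class_def)
  show "Dom Dual (span_class v c) = Cod E v"
    using the_elem_span_class[OF assms, of "\<lambda>v c. Cod E v"] span_action_eq_pa assms
    unfolding fib_dual_sel by blast
  show "Cod Dual (span_class v c) = Cod E c"
    using the_elem_span_class[OF assms, of "\<lambda>v c. Cod E c"] span_action_eq_pa assms
    unfolding fib_dual_sel by blast
  show "dual_map pa (span_class v c) = pa c"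
    using the_elem_span_class[OF assms, of "\<lambda>v c. pa c"] span_action_eq_pa assms
    unfolding dual_map_def by blast
  show "action (span_class v c) = span_action v c"
    unfolding action_def span_class_eq[OF assms] using assms by auto
qed

lemma dual_arrE:
  assumes "F \<in> Arr Dual"
  obtains v c where "(v, c) \<in> Spans" "F = span_class v c"
proof -
  have "F \<in> Spans // dual_equiv E B po pa" using assms by (simp add: fib_dual_sel(2))
  then obtain p where "p \<in> Spans" "F = dual_equiv E B po pa `` {p}" by (rule quotientE)
  then show ?thesis using that[of "fst p" "snd p"] by (simp add: dual_class_def)
qed

lemma dual_arr:
  assumes "F \<in> Arr Dual"
  shows "Dom Dual F \<in> Obj E" "Cod Dual F \<in> Obj E" "dual_map pa F \<in> Arr B"
    "Dom B (dual_map pa F) = po (Dom Dual F)" "Cod B (dual_map pa F) = po (Cod Dual F)"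
proof -
  from assms obtain v c where vc: "(v, c) \<in> Spans" and F: "F = span_class v c" by (rule dual_arrE)
  note d = SpansD[OF vc] and s = span_class_arr[OF vc]
  show "Dom Dual F \<in> Obj E" "Cod Dual F \<in> Obj E" "dual_map pa F \<in> Arr B"
    "Dom B (dual_map pa F) = po (Dom Dual F)" "Cod B (dual_map pa F) = po (Cod Dual F)"
    unfolding F s using d by (simp_all add: E.Cod_Obj)
qed

lemma action_inject:
  assumes "F \<in> Arr Dual" "G \<in> Arr Dual" "action F = action G"
  shows "F = G"
proof -
  from assms(1) obtain v c where vc: "(v, c) \<in> Spans" and F: "F = span_class v c" by (rule dual_arrE)
  from assms(2) obtain v' c' where vc': "(v', c') \<in> Spans" and G: "G = span_class v' c'" by (rule dual_arrE)
  have "span_action v c = span_action v' c'"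
    using assms(3) unfolding F G span_class_arr(5)[OF vc] span_class_arr(5)[OF vc'] .
  then show ?thesis unfolding F G span_class_eq[OF vc] span_class_eq[OF vc'] by simp
qed

lemma actionD:
  assumes "F \<in> Arr Dual" "(x, y) \<in> action F"
  shows "x \<in> Arr E" "y \<in> Arr E" "Dom E x = Dom E y" "Cod E x = Dom Dual F" "Cod E y = Cod Dual F"
    "pa x \<cdot>\<^bsub>B\<^esub> dual_map pa F = pa y" "pa x \<cdot>\<^bsub>B\<^esub> \<rho>\<^bsub>B\<^esub> (dual_map pa F) = pa x"
proof -
  from assms(1) obtain v c where vc: "(v, c) \<in> Spans" and F: "F = span_class v c" by (rule dual_arrE)
  have "(x, y) \<in> span_action v c" using assms(2) unfolding F span_class_arr(5)[OF vc] .
  note d = span_actionD[OF vc this]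
  show "x \<in> Arr E" "y \<in> Arr E" "Dom E x = Dom E y" "Cod E x = Dom Dual F" "Cod E y = Cod Dual F"
    "pa x \<cdot>\<^bsub>B\<^esub> dual_map pa F = pa y" "pa x \<cdot>\<^bsub>B\<^esub> \<rho>\<^bsub>B\<^esub> (dual_map pa F) = pa x"
    unfolding F span_class_arr[OF vc] by (fact d)+
qed

text \<open>Whatever representatives and latent pullback are chosen, the resulting span acts as the
  same relational composite, hence has the same class. A latent pullback exists, so the union runs
  over exactly one class.\<close>

lemma span_class_comp:
  assumes s1: "(v1, c1) \<in> Spans" and s2: "(v2, c2) \<in> Spans" and cod: "Cod E c1 = Cod E v2"
  obtains v c where "(v, c) \<in> Spans" "span_class v1 c1 \<cdot>\<^bsub>Dual\<^esub> span_class v2 c2 = span_class v c"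
    "Cod E v = Cod E v1" "Cod E c = Cod E c2" "pa c = pa c1 \<cdot>\<^bsub>B\<^esub> pa c2"
    "span_action v c = span_action v1 c1 O span_action v2 c2"
proof -
  note d1 = SpansD[OF s1] and d2 = SpansD[OF s2]
  obtain t s where pb: "latent_pullback E t v2 s c1" "subvertical E B po pa s" "Prone t"
    and pt: "pa t = pa c1 \<cdot>\<^bsub>B\<^esub> \<rho>\<^bsub>B\<^esub> (pa c2)"
    using s1 s2 cod[symmetric] by (rule latent_pullback_exists)
  note sq = latent_pullback_square[OF pb(1)]
  let ?v = "s \<cdot>\<^bsub>E\<^esub> v1" and ?c = "t \<cdot>\<^bsub>E\<^esub> c2"
  note sp = latent_pullback_span[OF s1 s2 pb]
  have "span_class v1 c1 \<cdot>\<^bsub>Dual\<^esub> span_class v2 c2 =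
    \<Union> {span_class (w \<cdot>\<^bsub>E\<^esub> v1') (d \<cdot>\<^bsub>E\<^esub> c2') | v1' c1' v2' c2' w d.
      (v1', c1') \<in> span_class v1 c1 \<and> (v2', c2') \<in> span_class v2 c2 \<and>
      latent_pullback E d v2' w c1' \<and> subvertical E B po pa w \<and> Prone d}" (is "_ = \<Union> ?S")
    by (rule fib_dual_sel)
  also have "?S = {span_class ?v ?c}"
  proof (intro set_eqI iffI)
    fix Z assume "Z \<in> ?S"
    then obtain v1' c1' v2' c2' w d where Z: "Z = span_class (w \<cdot>\<^bsub>E\<^esub> v1') (d \<cdot>\<^bsub>E\<^esub> c2')"
      and c1: "(v1', c1') \<in> span_class v1 c1" and c2: "(v2', c2') \<in> span_class v2 c2"
      and pb': "latent_pullback E d v2' w c1'" "subvertical E B po pa w" "Prone d" by blast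
    have s1': "(v1', c1') \<in> Spans" "span_action v1' c1' = span_action v1 c1"
      using c1 by (simp_all add: span_class_eq[OF s1])
    have s2': "(v2', c2') \<in> Spans" "span_action v2' c2' = span_action v2 c2"
      using c2 by (simp_all add: span_class_eq[OF s2])
    note sp' = latent_pullback_span[OF s1'(1) s2'(1) pb']
    show "Z \<in> {span_class ?v ?c}"
      unfolding Z span_class_eq[OF sp'(1)] span_class_eq[OF sp(1)] sp(2) sp'(2) s1'(2) s2'(2) by simp
  next
    fix Z assume "Z \<in> {span_class ?v ?c}"
    moreover have "(v1, c1) \<in> span_class v1 c1" "(v2, c2) \<in> span_class v2 c2"
      using s1 s2 by (simp_all add: span_class_eq)
    ultimately show "Z \<in> ?S" using pb by blast
  qed
  finally have "span_class v1 c1 \<cdot>\<^bsub>Dual\<^esub> span_class v2 c2 = span_class ?v ?c" by simp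
  \<comment> \<open>The leg t lies over \<open>pa c1 \<cdot> \<rho> (pa c2)\<close>, and R.1 removes
    the restriction in front of \<open>pa c2\<close>.\<close>
  moreover have "pa ?c = pa c1 \<cdot>\<^bsub>B\<^esub> pa c2" "Cod E ?v = Cod E v1" "Cod E ?c = Cod E c2"
    using sq d1 d2 cod pt by (simp_all add: B.assoc)
  ultimately show ?thesis using that sp by blast
qed

lemma dual_comp:
  assumes "F \<in> Arr Dual" "G \<in> Arr Dual" "Cod Dual F = Dom Dual G"
  shows "F \<cdot>\<^bsub>Dual\<^esub> G \<in> Arr Dual" "Dom Dual (F \<cdot>\<^bsub>Dual\<^esub> G) = Dom Dual F"
    "Cod Dual (F \<cdot>\<^bsub>Dual\<^esub> G) = Cod Dual G"
    "dual_map pa (F \<cdot>\<^bsub>Dual\<^esub> G) = dual_map pa F \<cdot>\<^bsub>B\<^esub> dual_map pa G"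
    "action (F \<cdot>\<^bsub>Dual\<^esub> G) = action F O action G"
proof -
  from assms(1) obtain v1 c1 where s1: "(v1, c1) \<in> Spans" and F: "F = span_class v1 c1" by (rule dual_arrE)
  from assms(2) obtain v2 c2 where s2: "(v2, c2) \<in> Spans" and G: "G = span_class v2 c2" by (rule dual_arrE)
  have cod: "Cod E c1 = Cod E v2" using assms(3) unfolding F G span_class_arr[OF s1] span_class_arr[OF s2] .
  obtain v c where vc: "(v, c) \<in> Spans" "F \<cdot>\<^bsub>Dual\<^esub> G = span_class v c"
    "Cod E v = Cod E v1" "Cod E c = Cod E c2" "pa c = pa c1 \<cdot>\<^bsub>B\<^esub> pa c2"
    "span_action v c = span_action v1 c1 O span_action v2 c2"
    unfolding F G using s1 s2 cod by (rule span_class_comp)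
  show "F \<cdot>\<^bsub>Dual\<^esub> G \<in> Arr Dual" "Dom Dual (F \<cdot>\<^bsub>Dual\<^esub> G) = Dom Dual F"
    "Cod Dual (F \<cdot>\<^bsub>Dual\<^esub> G) = Cod Dual G"
    "dual_map pa (F \<cdot>\<^bsub>Dual\<^esub> G) = dual_map pa F \<cdot>\<^bsub>B\<^esub> dual_map pa G"
    "action (F \<cdot>\<^bsub>Dual\<^esub> G) = action F O action G"
    unfolding vc(2) span_class_arr[OF vc(1)] unfolding F G span_class_arr[OF s1] span_class_arr[OF s2]
    by (fact vc(3-6) span_class_arr(1)[OF vc(1)])+
qed

text \<open>For an idempotent, landing in the domain of e means \<open>k \<cdot> e = k\<close>. All
  pairs are therefore diagonal, and by reflection the points are selected by a condition in
  B.\<close>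

lemma span_ridem:
  assumes "e \<in> ridem E X"
  shows "(e, e) \<in> Spans"
    "span_action e e = Id_on {x \<in> Arr E. Cod E x = X \<and> pa x \<cdot>\<^bsub>B\<^esub> pa e = pa x}"
proof -
  have e: "e \<in> Arr E" "Dom E e = X" "Cod E e = X" "\<rho>\<^bsub>E\<^esub> e = e" using assms by (auto simp: E.ridem_iff)
  have pe: "\<rho>\<^bsub>B\<^esub> (pa e) = pa e" using pa_restr[of e] e by simp
  show "(e, e) \<in> Spans" using Prone_ridem[OF assms] e pe by (simp add: Spans_iff)
  show "span_action e e = Id_on {x \<in> Arr E. Cod E x = X \<and> pa x \<cdot>\<^bsub>B\<^esub> pa e = pa x}"
  proof (intro equalityI subsetI)
    fix z assume "z \<in> span_action e e"
    then obtain k where "k \<in> Arr E" "Cod E k = X" "k \<cdot>\<^bsub>E\<^esub> e = k" "z = (k, k)"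
      using e by (auto simp: span_action_def)
    then show "z \<in> Id_on {x \<in> Arr E. Cod E x = X \<and> pa x \<cdot>\<^bsub>B\<^esub> pa e = pa x}"
      using e pe comp_restr_reflect[of k e] by (simp add: Id_on_iff)
  next
    fix z assume "z \<in> Id_on {x \<in> Arr E. Cod E x = X \<and> pa x \<cdot>\<^bsub>B\<^esub> pa e = pa x}"
    then obtain k where k: "k \<in> Arr E" "Cod E k = X" "pa k \<cdot>\<^bsub>B\<^esub> pa e = pa k" "z = (k, k)" by auto
    then have "k \<cdot>\<^bsub>E\<^esub> e = k" using e pe comp_restr_reflect[of k e] by simp
    then show "z \<in> span_action e e"
      unfolding span_action_def k(4) using e k(1,2) by (intro CollectI exI[of _ k]) simp
  qed
qed

text \<open>The idempotent exists by hyperconnectedness at \<open>Cod E v\<close>: v ends there, so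
  \<open>pa v\<close> absorbs the image of that identity.\<close>

lemma hat_eq:
  assumes "(v, c) \<in> Spans"
  shows "hat E B po pa v \<in> ridem E (Cod E v)" "pa (hat E B po pa v) = \<rho>\<^bsub>B\<^esub> (pa c)"
proof -
  note d = SpansD[OF assms]
  have "pa v \<cdot>\<^bsub>B\<^esub> pa (Id E (Cod E v)) = pa v" using d(3) by (simp only: pa_comp_id)
  moreover have "pa v \<in> ridem B (po (Cod E v))" using d by (simp add: B.ridem_iff)
  ultimately obtain e where e: "e \<in> ridem E (Cod E v)" "pa e = pa v"
    using ridem_over E.Cod_Obj[OF d(3)] by blast
  then have "hat E B po pa v = e" unfolding hat_def using ridem_inject by (intro the_equality) auto
  then show "hat E B po pa v \<in> ridem E (Cod E v)" "pa (hat E B po pa v) = \<rho>\<^bsub>B\<^esub> (pa c)"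
    using e d(6) by simp_all
qed

lemma dual_restr:
  assumes "F \<in> Arr Dual"
  shows "\<rho>\<^bsub>Dual\<^esub> F \<in> Arr Dual" "Dom Dual (\<rho>\<^bsub>Dual\<^esub> F) = Dom Dual F" "Cod Dual (\<rho>\<^bsub>Dual\<^esub> F) = Dom Dual F"
    "dual_map pa (\<rho>\<^bsub>Dual\<^esub> F) = \<rho>\<^bsub>B\<^esub> (dual_map pa F)"
    "action (\<rho>\<^bsub>Dual\<^esub> F) =
       Id_on {x \<in> Arr E. Cod E x = Dom Dual F \<and> pa x \<cdot>\<^bsub>B\<^esub> \<rho>\<^bsub>B\<^esub> (dual_map pa F) = pa x}"
proof -
  from assms obtain v c where s: "(v, c) \<in> Spans" and F: "F = span_class v c" by (rule dual_arrE)
  let ?h = "hat E B po pa v"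
  note h = hat_eq[OF s] and hs = span_ridem[OF hat_eq(1)[OF s]]
  \<comment> \<open>The hat depends only on \<open>Cod E v\<close> and \<open>pa c\<close>, which
    are determined by the action, so every representative contributes the same class.\<close>
  have hat: "hat E B po pa v' = ?h" if "(v', c') \<in> F" for v' c'
  proof -
    have s': "(v', c') \<in> Spans" "span_action v' c' = span_action v c"
      using that by (simp_all add: F span_class_eq[OF s])
    then show ?thesis
      using hat_eq[OF s'(1)] h span_action_eq_pa[OF s'(1) s s'(2)]
      by (intro ridem_inject[of _ "Cod E v"]) simp_all
  qed
  have F0: "(v, c) \<in> F" using s by (simp add: F span_class_eq)
  have "{span_class (hat E B po pa v') (hat E B po pa v') | v' c'. (v', c') \<in> F}
      = {span_class ?h ?h}" (is "?S = _")
  proof (intro equalityI subsetI)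
    fix Z assume "Z \<in> ?S"
    then obtain v' c' where "Z = span_class (hat E B po pa v') (hat E B po pa v')" "(v', c') \<in> F"
      by auto
    then show "Z \<in> {span_class ?h ?h}" using hat by simp
  qed (use F0 in auto)
  then have r: "\<rho>\<^bsub>Dual\<^esub> F = span_class ?h ?h" unfolding fib_dual_sel by simp
  have hc: "Dom E ?h = Cod E v" "Cod E ?h = Cod E v" using h(1) by (auto simp: E.ridem_iff)
  show "\<rho>\<^bsub>Dual\<^esub> F \<in> Arr Dual" "Dom Dual (\<rho>\<^bsub>Dual\<^esub> F) = Dom Dual F" "Cod Dual (\<rho>\<^bsub>Dual\<^esub> F) = Dom Dual F"
    "dual_map pa (\<rho>\<^bsub>Dual\<^esub> F) = \<rho>\<^bsub>B\<^esub> (dual_map pa F)"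
    "action (\<rho>\<^bsub>Dual\<^esub> F) =
       Id_on {x \<in> Arr E. Cod E x = Dom Dual F \<and> pa x \<cdot>\<^bsub>B\<^esub> \<rho>\<^bsub>B\<^esub> (dual_map pa F) = pa x}"
    unfolding r span_class_arr(2-5)[OF hs(1)] hs(2) h(2) hc unfolding F span_class_arr(2-5)[OF s]
    by (rule span_class_arr(1)[OF hs(1)] refl)+
qed

lemma dual_id:
  assumes "X \<in> Obj E"
  shows "Id Dual X \<in> Arr Dual" "Dom Dual (Id Dual X) = X" "Cod Dual (Id Dual X) = X"
    "dual_map pa (Id Dual X) = pa (Id E X)" "action (Id Dual X) = Id_on {x \<in> Arr E. Cod E x = X}"
proof -
  have e: "Id E X \<in> ridem E X" using assms by (simp add: E.ridem_iff)
  note s = span_ridem[OF e]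
  \<comment> \<open>Every map into X absorbs the image of the identity of X, so the condition from
    \<open>span_ridem\<close> always holds.\<close>
  have *: "{x \<in> Arr E. Cod E x = X \<and> pa x \<cdot>\<^bsub>B\<^esub> pa (Id E X) = pa x} = {x \<in> Arr E. Cod E x = X}"
    using pa_comp_id[of _ X] by blast
  have i: "Id Dual X = span_class (Id E X) (Id E X)" by (rule fib_dual_sel)
  show "Id Dual X \<in> Arr Dual" "Dom Dual (Id Dual X) = X" "Cod Dual (Id Dual X) = X"
    "dual_map pa (Id Dual X) = pa (Id E X)" "action (Id Dual X) = Id_on {x \<in> Arr E. Cod E x = X}"
    unfolding i span_class_arr(2-5)[OF s(1)] s(2) * E.arr_id(3)[OF assms]
    by (rule span_class_arr(1)[OF s(1)] refl)+
qed

section \<open>Restriction category axioms and the semifunctor to B\<close>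

lemma dual_restriction_category: "restriction_category Dual"
proof
  fix F assume F: "F \<in> Arr Dual"
  show "Dom Dual F \<in> Obj Dual" "Cod Dual F \<in> Obj Dual"
    using dual_arr(1,2)[OF F] by (simp_all add: fib_dual_sel(1))
next
  fix X assume "X \<in> Obj Dual"
  then have "X \<in> Obj E" by (simp add: fib_dual_sel(1))
  then show "Id Dual X \<in> Hom Dual X X" using dual_id[of X] by (simp add: Hom_def)
next
  fix F G X Y Z assume "F \<in> Hom Dual X Y" "G \<in> Hom Dual Y Z"
  then show "F \<cdot>\<^bsub>Dual\<^esub> G \<in> Hom Dual X Z" using dual_comp[of F G] by (simp add: Hom_def)
next
  fix F X Y assume "F \<in> Hom Dual X Y"
  then have F: "F \<in> Arr Dual" "Dom Dual F = X" "Cod Dual F = Y" by (simp_all add: Hom_def)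
  have X: "X \<in> Obj E" "Y \<in> Obj E" using dual_arr(1,2)[OF F(1)] F by simp_all
  note i = dual_id[OF X(1)] and j = dual_id[OF X(2)] and r = dual_restr[OF F(1)]
  \<comment> \<open>The left identity law and R.1 are one fact about relations: precomposing with
    the identity on a set that contains the domain of \<open>action F\<close> changes
    nothing.\<close>
  have unit: "G \<cdot>\<^bsub>Dual\<^esub> F = F"
    if G: "G \<in> Arr Dual" "Cod Dual G = X" "action G = Id_on P"
      and P: "\<And>x y. (x, y) \<in> action F \<Longrightarrow> x \<in> P" for G P
  proof (rule action_inject[OF _ F(1)])
    have GF: "Cod Dual G = Dom Dual F" using G(2) F(2) by simp
    show "G \<cdot>\<^bsub>Dual\<^esub> F \<in> Arr Dual" by (rule dual_comp(1)[OF G(1) F(1) GF])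
    show "action (G \<cdot>\<^bsub>Dual\<^esub> F) = action F" unfolding dual_comp(5)[OF G(1) F(1) GF] G(3) using P by auto
  qed
  show "Id Dual X \<cdot>\<^bsub>Dual\<^esub> F = F"
    using i(1,3,5) by (rule unit) (use actionD(1,4)[OF F(1)] F(2) in blast)
  have rc: "Cod Dual (\<rho>\<^bsub>Dual\<^esub> F) = X" using r(3) F(2) by simp
  show "\<rho>\<^bsub>Dual\<^esub> F \<cdot>\<^bsub>Dual\<^esub> F = F"
    using r(1) rc r(5) by (rule unit) (use actionD(1,4,7)[OF F(1)] in blast)
  show "\<rho>\<^bsub>Dual\<^esub> F \<in> Hom Dual X X" using r F by (simp add: Hom_def)
  have FI: "Cod Dual F = Dom Dual (Id Dual Y)" using j(2) F(3) by simp
  show "F \<cdot>\<^bsub>Dual\<^esub> Id Dual Y = F"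
  proof (rule action_inject[OF dual_comp(1)[OF F(1) j(1) FI] F(1)])
    have "y \<in> {x \<in> Arr E. Cod E x = Y}" if "(x, y) \<in> action F" for x y
      using actionD(2,5)[OF F(1) that] F(3) by simp
    then show "action (F \<cdot>\<^bsub>Dual\<^esub> Id Dual Y) = action F"
      unfolding dual_comp(5)[OF F(1) j(1) FI] j(5) by auto
  qed
next
  fix F G H W X Y Z assume "F \<in> Hom Dual W X" "G \<in> Hom Dual X Y" "H \<in> Hom Dual Y Z"
  then have a: "F \<in> Arr Dual" "Dom Dual F = W" "Cod Dual F = X" "G \<in> Arr Dual" "Dom Dual G = X"
    "Cod Dual G = Y" "H \<in> Arr Dual" "Dom Dual H = Y" "Cod Dual H = Z" by (simp_all add: Hom_def)
  have FG: "Cod Dual F = Dom Dual G" and GH: "Cod Dual G = Dom Dual H" using a by simp_all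
  note fg = dual_comp[OF a(1,4) FG] and gh = dual_comp[OF a(4,7) GH]
  have l: "Cod Dual (F \<cdot>\<^bsub>Dual\<^esub> G) = Dom Dual H" and r: "Cod Dual F = Dom Dual (G \<cdot>\<^bsub>Dual\<^esub> H)"
    unfolding fg(3) gh(2) using FG GH by simp_all
  note fgh = dual_comp[OF fg(1) a(7) l] and fgh' = dual_comp[OF a(1) gh(1) r]
  have "action ((F \<cdot>\<^bsub>Dual\<^esub> G) \<cdot>\<^bsub>Dual\<^esub> H) = action (F \<cdot>\<^bsub>Dual\<^esub> (G \<cdot>\<^bsub>Dual\<^esub> H))"
    unfolding fgh(5) fgh'(5) fg(5) gh(5) by (rule O_assoc)
  then show "(F \<cdot>\<^bsub>Dual\<^esub> G) \<cdot>\<^bsub>Dual\<^esub> H = F \<cdot>\<^bsub>Dual\<^esub> (G \<cdot>\<^bsub>Dual\<^esub> H)"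
    by (rule action_inject[OF fgh(1) fgh'(1)])
next
  fix F G X Y Z assume "F \<in> Hom Dual X Y" "G \<in> Hom Dual X Z"
  then have a: "F \<in> Arr Dual" "Dom Dual F = X" "G \<in> Arr Dual" "Dom Dual G = X"
    by (simp_all add: Hom_def)
  note f = dual_restr[OF a(1)] and g = dual_restr[OF a(3)]
  have cod: "Cod Dual (\<rho>\<^bsub>Dual\<^esub> F) = Dom Dual (\<rho>\<^bsub>Dual\<^esub> G)" "Cod Dual (\<rho>\<^bsub>Dual\<^esub> G) = Dom Dual (\<rho>\<^bsub>Dual\<^esub> F)"
    "Cod Dual (\<rho>\<^bsub>Dual\<^esub> F) = Dom Dual G" unfolding f(2,3) g(2,3) a(2,4) by (rule refl)+
  note fg = dual_comp[OF f(1) g(1) cod(1)] and gf = dual_comp[OF g(1) f(1) cod(2)]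
    and rg = dual_comp[OF f(1) a(3) cod(3)]
  have O: "Id_on P O Id_on Q = Id_on (P \<inter> Q)" for P Q :: "'m set" by auto
  show "\<rho>\<^bsub>Dual\<^esub> F \<cdot>\<^bsub>Dual\<^esub> \<rho>\<^bsub>Dual\<^esub> G = \<rho>\<^bsub>Dual\<^esub> G \<cdot>\<^bsub>Dual\<^esub> \<rho>\<^bsub>Dual\<^esub> F"
  proof (rule action_inject[OF fg(1) gf(1)])
    show "action (\<rho>\<^bsub>Dual\<^esub> F \<cdot>\<^bsub>Dual\<^esub> \<rho>\<^bsub>Dual\<^esub> G) = action (\<rho>\<^bsub>Dual\<^esub> G \<cdot>\<^bsub>Dual\<^esub> \<rho>\<^bsub>Dual\<^esub> F)"
      unfolding fg(5) gf(5) f(5) g(5) O by (subst Int_commute) (rule refl)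
  qed
  have rFG: "\<rho>\<^bsub>Dual\<^esub> F \<cdot>\<^bsub>Dual\<^esub> G \<in> Arr Dual" "Dom Dual (\<rho>\<^bsub>Dual\<^esub> F \<cdot>\<^bsub>Dual\<^esub> G) = X"
    "dual_map pa (\<rho>\<^bsub>Dual\<^esub> F \<cdot>\<^bsub>Dual\<^esub> G) = \<rho>\<^bsub>B\<^esub> (dual_map pa F) \<cdot>\<^bsub>B\<^esub> dual_map pa G"
    unfolding rg(2,4) f(2,4) a(2) using rg(1) by simp_all
  let ?f = "dual_map pa F" and ?g = "dual_map pa G"
  note B = dual_arr[OF a(1)] dual_arr[OF a(3)]
  \<comment> \<open>Both sides of R.3 act as partial identities, so only their sets of points need
    comparing: landing in the domain of \<open>\<rho> ?f \<cdot> ?g\<close> means landing in the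
    domains of both.\<close>
  have iff: "p \<cdot>\<^bsub>B\<^esub> \<rho>\<^bsub>B\<^esub> (\<rho>\<^bsub>B\<^esub> ?f \<cdot>\<^bsub>B\<^esub> ?g) = p \<longleftrightarrow> p \<cdot>\<^bsub>B\<^esub> \<rho>\<^bsub>B\<^esub> ?f = p \<and> p \<cdot>\<^bsub>B\<^esub> \<rho>\<^bsub>B\<^esub> ?g = p"
    if p: "p \<in> Arr B" "Cod B p = po X" for p
  proof
    assume L: "p \<cdot>\<^bsub>B\<^esub> \<rho>\<^bsub>B\<^esub> (\<rho>\<^bsub>B\<^esub> ?f \<cdot>\<^bsub>B\<^esub> ?g) = p"
    have 1: "p \<cdot>\<^bsub>B\<^esub> \<rho>\<^bsub>B\<^esub> ?f = p"
      using B.comp_restr_comp_left[of p "\<rho>\<^bsub>B\<^esub> ?f" ?g] L p B a by simp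
    then show "p \<cdot>\<^bsub>B\<^esub> \<rho>\<^bsub>B\<^esub> ?f = p \<and> p \<cdot>\<^bsub>B\<^esub> \<rho>\<^bsub>B\<^esub> ?g = p"
      using B.comp_restr_comp_right[of p "\<rho>\<^bsub>B\<^esub> ?f" ?g] L p B a by simp
  next
    assume "p \<cdot>\<^bsub>B\<^esub> \<rho>\<^bsub>B\<^esub> ?f = p \<and> p \<cdot>\<^bsub>B\<^esub> \<rho>\<^bsub>B\<^esub> ?g = p"
    then show "p \<cdot>\<^bsub>B\<^esub> \<rho>\<^bsub>B\<^esub> (\<rho>\<^bsub>B\<^esub> ?f \<cdot>\<^bsub>B\<^esub> ?g) = p"
      using B.comp_restr_comp[of p "\<rho>\<^bsub>B\<^esub> ?f" ?g] p B a by simp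
  qed
  show "\<rho>\<^bsub>Dual\<^esub> (\<rho>\<^bsub>Dual\<^esub> F \<cdot>\<^bsub>Dual\<^esub> G) = \<rho>\<^bsub>Dual\<^esub> F \<cdot>\<^bsub>Dual\<^esub> \<rho>\<^bsub>Dual\<^esub> G"
  proof (rule action_inject[OF dual_restr(1)[OF rFG(1)] fg(1)])
    have "{x \<in> Arr E. Cod E x = X \<and> pa x \<cdot>\<^bsub>B\<^esub> \<rho>\<^bsub>B\<^esub> (\<rho>\<^bsub>B\<^esub> ?f \<cdot>\<^bsub>B\<^esub> ?g) = pa x}
        = {x \<in> Arr E. Cod E x = X \<and> pa x \<cdot>\<^bsub>B\<^esub> \<rho>\<^bsub>B\<^esub> ?f = pa x} \<inter>
          {x \<in> Arr E. Cod E x = X \<and> pa x \<cdot>\<^bsub>B\<^esub> \<rho>\<^bsub>B\<^esub> ?g = pa x}"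
      using iff[OF pa_arr(1)] pa_arr(3) by blast
    then show "action (\<rho>\<^bsub>Dual\<^esub> (\<rho>\<^bsub>Dual\<^esub> F \<cdot>\<^bsub>Dual\<^esub> G)) = action (\<rho>\<^bsub>Dual\<^esub> F \<cdot>\<^bsub>Dual\<^esub> \<rho>\<^bsub>Dual\<^esub> G)"
      unfolding dual_restr(5)[OF rFG(1)] rFG(2,3) fg(5) f(5) g(5) a(2,4) O by (rule arg_cong)
  qed
next
  fix F G X Y Z assume "F \<in> Hom Dual X Y" "G \<in> Hom Dual Y Z"
  then have a: "F \<in> Arr Dual" "Dom Dual F = X" "Cod Dual F = Y" "G \<in> Arr Dual" "Dom Dual G = Y"
    by (simp_all add: Hom_def)
  have FG: "F \<cdot>\<^bsub>Dual\<^esub> G \<in> Arr Dual" "Dom Dual (F \<cdot>\<^bsub>Dual\<^esub> G) = X"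
    "dual_map pa (F \<cdot>\<^bsub>Dual\<^esub> G) = dual_map pa F \<cdot>\<^bsub>B\<^esub> dual_map pa G"
    using dual_comp[of F G] a by simp_all
  note g = dual_restr[OF a(4)] and fg = dual_restr[OF FG(1)]
  have fg': "Cod Dual (\<rho>\<^bsub>Dual\<^esub> (F \<cdot>\<^bsub>Dual\<^esub> G)) = Dom Dual F" using fg FG a by simp
  have gf: "Cod Dual F = Dom Dual (\<rho>\<^bsub>Dual\<^esub> G)" using g a by simp
  note l = dual_comp[OF a(1) g(1) gf] and r = dual_comp[OF fg(1) a(1) fg']
  let ?f = "dual_map pa F" and ?g = "dual_map pa G"
  note B = dual_arr[OF a(1)] dual_arr[OF a(4)]
  \<comment> \<open>Pairs in the action satisfy \<open>pa x \<cdot> ?f = pa y\<close>. A domain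
    condition for \<open>?g\<close> on y is thus one for \<open>?f \<cdot> ?g\<close> on x, which is
    R.4 for the relations.\<close>
  have iff: "pa y \<cdot>\<^bsub>B\<^esub> \<rho>\<^bsub>B\<^esub> ?g = pa y \<longleftrightarrow> pa x \<cdot>\<^bsub>B\<^esub> \<rho>\<^bsub>B\<^esub> (?f \<cdot>\<^bsub>B\<^esub> ?g) = pa x"
    if "(x, y) \<in> action F" for x y
  proof -
    note d = actionD[OF a(1) that]
    show ?thesis
      using B.comp_restr_comp[of "pa x" ?f ?g] B.comp_restr_comp_right[of "pa x" ?f ?g] d B a by auto
  qed
  show "F \<cdot>\<^bsub>Dual\<^esub> \<rho>\<^bsub>Dual\<^esub> G = \<rho>\<^bsub>Dual\<^esub> (F \<cdot>\<^bsub>Dual\<^esub> G) \<cdot>\<^bsub>Dual\<^esub> F"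
  proof (rule action_inject[OF l(1) r(1)])
    show "action (F \<cdot>\<^bsub>Dual\<^esub> \<rho>\<^bsub>Dual\<^esub> G) = action (\<rho>\<^bsub>Dual\<^esub> (F \<cdot>\<^bsub>Dual\<^esub> G) \<cdot>\<^bsub>Dual\<^esub> F)"
    proof (rule equalityI; rule subrelI)
      fix x y assume "(x, y) \<in> action (F \<cdot>\<^bsub>Dual\<^esub> \<rho>\<^bsub>Dual\<^esub> G)"
      then have xy: "(x, y) \<in> action F" "pa y \<cdot>\<^bsub>B\<^esub> \<rho>\<^bsub>B\<^esub> ?g = pa y" unfolding l(5) g(5) by auto
      then show "(x, y) \<in> action (\<rho>\<^bsub>Dual\<^esub> (F \<cdot>\<^bsub>Dual\<^esub> G) \<cdot>\<^bsub>Dual\<^esub> F)"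
        unfolding r(5) fg(5) FG(2,3) using iff[OF xy(1)] actionD[OF a(1) xy(1)] a by auto
    next
      fix x y assume "(x, y) \<in> action (\<rho>\<^bsub>Dual\<^esub> (F \<cdot>\<^bsub>Dual\<^esub> G) \<cdot>\<^bsub>Dual\<^esub> F)"
      then have xy: "(x, y) \<in> action F" "pa x \<cdot>\<^bsub>B\<^esub> \<rho>\<^bsub>B\<^esub> (?f \<cdot>\<^bsub>B\<^esub> ?g) = pa x"
        unfolding r(5) fg(5) FG(2,3) by auto
      then show "(x, y) \<in> action (F \<cdot>\<^bsub>Dual\<^esub> \<rho>\<^bsub>Dual\<^esub> G)"
        unfolding l(5) g(5) using iff[OF xy(1)] actionD[OF a(1) xy(1)] a by auto
    qed
  qed
qed

lemma dual_semifunctor: "restriction_semifunctor Dual B po (dual_map pa)"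
proof (intro restriction_semifunctor.intro restriction_semifunctor_axioms.intro)
  show "restriction_category Dual" by (rule dual_restriction_category)
  show "restriction_category B" by (rule B.restriction_category_axioms)
  fix X assume "X \<in> Obj Dual"
  then show "po X \<in> Obj B" using map_Obj by (simp add: fib_dual_sel(1))
next
  fix F X Y assume "F \<in> Hom Dual X Y"
  then have F: "F \<in> Arr Dual" "Dom Dual F = X" "Cod Dual F = Y" by (simp_all add: Hom_def)
  show "dual_map pa F \<in> Hom B (po X) (po Y)" using dual_arr[OF F(1)] F by (simp add: Hom_def)
  show "dual_map pa (\<rho>\<^bsub>Dual\<^esub> F) = \<rho>\<^bsub>B\<^esub> (dual_map pa F)" by (rule dual_restr(4)[OF F(1)])
next
  fix F G X Y Z assume "F \<in> Hom Dual X Y" "G \<in> Hom Dual Y Z"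
  then show "dual_map pa (F \<cdot>\<^bsub>Dual\<^esub> G) = dual_map pa F \<cdot>\<^bsub>B\<^esub> dual_map pa G"
    using dual_comp(4)[of F G] by (simp add: Hom_def)
qed

section \<open>Prone maps of the dual\<close>

lemma action_prone_span:
  assumes "Prone c"
  shows "(\<rho>\<^bsub>E\<^esub> c, c) \<in> Spans"
    "(z, y) \<in> span_action (\<rho>\<^bsub>E\<^esub> c) c \<longleftrightarrow>
       z \<in> Arr E \<and> Cod E z = Dom E c \<and> z \<cdot>\<^bsub>E\<^esub> \<rho>\<^bsub>E\<^esub> c = z \<and> y = z \<cdot>\<^bsub>E\<^esub> c"
proof -
  have c: "c \<in> Arr E" using assms by (rule Prone_arr)
  show "(\<rho>\<^bsub>E\<^esub> c, c) \<in> Spans" using assms c by (simp add: Spans_iff)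
  show "(z, y) \<in> span_action (\<rho>\<^bsub>E\<^esub> c) c \<longleftrightarrow>
      z \<in> Arr E \<and> Cod E z = Dom E c \<and> z \<cdot>\<^bsub>E\<^esub> \<rho>\<^bsub>E\<^esub> c = z \<and> y = z \<cdot>\<^bsub>E\<^esub> c" (is "_ \<longleftrightarrow> ?R")
  proof
    assume "?R"
    then show "(z, y) \<in> span_action (\<rho>\<^bsub>E\<^esub> c) c"
      unfolding span_action_def by (intro CollectI exI[of _ z]) simp
  qed (auto simp: span_action_def)
qed

text \<open>The relation of this class is the graph of postcomposition with c, on maps landing in
  the domain of c. Uniqueness is not argued on representatives, since competing factorisations may
  have different apexes. Instead the action of any factorisation is described by G and h
  alone.\<close>

lemma dual_prone:
  assumes "Prone c"
  shows "prone Dual B po (dual_map pa) (span_class (\<rho>\<^bsub>E\<^esub> c) c)"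
proof -
  have c: "c \<in> Arr E" using assms by (rule Prone_arr)
  let ?F = "span_class (\<rho>\<^bsub>E\<^esub> c) c"
  note s = action_prone_span(1)[OF assms]
  have F: "?F \<in> Arr Dual" "Dom Dual ?F = Dom E c" "Cod Dual ?F = Cod E c" "dual_map pa ?F = pa c"
    using span_class_arr[OF s] c by simp_all
  have aF: "(z, y) \<in> action ?F \<longleftrightarrow>
       z \<in> Arr E \<and> Cod E z = Dom E c \<and> z \<cdot>\<^bsub>E\<^esub> \<rho>\<^bsub>E\<^esub> c = z \<and> y = z \<cdot>\<^bsub>E\<^esub> c" for z y
    unfolding span_class_arr(5)[OF s] by (rule action_prone_span(2)[OF assms])
  interpret D: restriction_category Dual by (rule dual_restriction_category)
  show ?thesis
    unfolding prone_def
  proof (intro conjI ballI impI)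
    fix Y G h
    assume "G \<in> Hom Dual Y (Cod Dual ?F)" "h \<in> Hom B (po Y) (po (Dom Dual ?F))"
      and t: "precise_triangle B h (dual_map pa ?F) (dual_map pa G)"
    then have G: "G \<in> Arr Dual" "Dom Dual G = Y" "Cod Dual G = Cod E c"
      and h: "h \<in> Arr B" "Dom B h = po Y" "Cod B h = po (Dom E c)"
      using F by (simp_all add: Hom_def)
    have hc: "h \<cdot>\<^bsub>B\<^esub> pa c = dual_map pa G" "h \<cdot>\<^bsub>B\<^esub> \<rho>\<^bsub>B\<^esub> (pa c) = h"
      using t F by (simp_all add: B.precise_triangle_iff)
    from G(1) obtain v d where vd: "(v, d) \<in> Spans" and Gvd: "G = span_class v d" by (rule dual_arrE)
    note sd = SpansD[OF vd] and cd = span_class_arr[OF vd, folded Gvd]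
    have d: "Cod E d = Cod E c" "Cod E v = Y" using cd G by simp_all
    have poY: "po (Dom E d) = po Y" using sd(5) d(2) by simp
    have hd: "h \<cdot>\<^bsub>B\<^esub> pa c = pa d" using hc(1) cd(4) by simp
    obtain k where k: "k \<in> Arr E" "Dom E k = Dom E d" "Cod E k = Dom E c" "pa k = h"
      "k \<cdot>\<^bsub>E\<^esub> c = d" "k \<cdot>\<^bsub>E\<^esub> \<rho>\<^bsub>E\<^esub> c = k"
      by (rule Prone_lift[OF assms sd(2) d(1) h(1) _ h(3) hd hc(2)]) (use h(2) poY in simp)
    \<comment> \<open>\<open>k \<cdot> c = d\<close> is prone and k lands in the domain of c, so k
      can replace d as the prone leg over the same v.\<close>
    have pk: "Prone k" using Prone_factor[of k c] assms sd(1) k by simp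
    have rkd: "\<rho>\<^bsub>E\<^esub> k = \<rho>\<^bsub>E\<^esub> d" using E.comp_restr_eq_iff[of k c] k c by simp
    then have "\<rho>\<^bsub>B\<^esub> (pa k) = \<rho>\<^bsub>B\<^esub> (pa d)" using pa_restr[of k] pa_restr[of d] k(1) sd(2) by simp
    then have vk: "(v, k) \<in> Spans" using sd k(1,2) pk by (simp add: Spans_iff)
    let ?K = "span_class v k"
    note K = span_class_arr[OF vk]
    have KF: "Cod Dual ?K = Dom Dual ?F" using K(3) F(2) k(3) by simp
    have "action (?K \<cdot>\<^bsub>Dual\<^esub> ?F) = action G"
      unfolding dual_comp(5)[OF K(1) F(1) KF] K(5) cd(5)
    proof (rule equalityI; rule subrelI)
      fix x y assume "(x, y) \<in> span_action v k O action ?F"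
      then obtain z where xz: "(x, z) \<in> span_action v k" and "(z, y) \<in> action ?F"
        by (rule relcompE) blast
      then have zy: "y = z \<cdot>\<^bsub>E\<^esub> c" by (simp add: aF)
      obtain l where l: "l \<in> Arr E" "Cod E l = Dom E k" "l \<cdot>\<^bsub>E\<^esub> \<rho>\<^bsub>E\<^esub> k = l"
        "x = l \<cdot>\<^bsub>E\<^esub> v" "z = l \<cdot>\<^bsub>E\<^esub> k" using vk xz by (rule span_actionE)
      have "y = l \<cdot>\<^bsub>E\<^esub> d" unfolding zy l(5) using l(1,2) k(1,3,5) c by (simp add: E.assoc)
      then show "(x, y) \<in> span_action v d"
        unfolding span_action_def using l rkd k(2) by auto
    next
      fix x y assume xy: "(x, y) \<in> span_action v d"
      obtain l where l: "l \<in> Arr E" "Cod E l = Dom E d" "l \<cdot>\<^bsub>E\<^esub> \<rho>\<^bsub>E\<^esub> d = l"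
        "x = l \<cdot>\<^bsub>E\<^esub> v" "y = l \<cdot>\<^bsub>E\<^esub> d" using vd xy by (rule span_actionE)
      have "(x, l \<cdot>\<^bsub>E\<^esub> k) \<in> span_action v k"
        unfolding span_action_def using l rkd k(2) by auto
      moreover have "(l \<cdot>\<^bsub>E\<^esub> k, y) \<in> action ?F"
        unfolding aF l(5) using l(1,2) k c by (simp add: E.assoc)
      ultimately show "(x, y) \<in> span_action v k O action ?F" by blast
    qed
    then have KG: "?K \<cdot>\<^bsub>Dual\<^esub> ?F = G"
      by (rule action_inject[OF dual_comp(1)[OF K(1) F(1) KF] G(1)])
    \<comment> \<open>The second component y lies over \<open>pa x \<cdot> h\<close>, and h lands in
      the domain of \<open>pa c\<close>.\<close>
    have image: "pa y \<cdot>\<^bsub>B\<^esub> \<rho>\<^bsub>B\<^esub> (pa c) = pa y"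
      if L: "L \<in> Arr Dual" "Cod Dual L = Dom E c" "dual_map pa L = h" and xy: "(x, y) \<in> action L" for L x y
    proof -
      note a = actionD[OF L(1) xy]
      have "pa y \<cdot>\<^bsub>B\<^esub> \<rho>\<^bsub>B\<^esub> (pa c) = pa x \<cdot>\<^bsub>B\<^esub> (h \<cdot>\<^bsub>B\<^esub> \<rho>\<^bsub>B\<^esub> (pa c))"
        using B.assoc[of "pa x" h "\<rho>\<^bsub>B\<^esub> (pa c)"] a h c L dual_arr[OF L(1)] by simp
      then show ?thesis using hc(2) a(6) L(3) by simp
    qed
    have precise: "L \<cdot>\<^bsub>Dual\<^esub> \<rho>\<^bsub>Dual\<^esub> ?F = L"
      if L: "L \<in> Arr Dual" "Cod Dual L = Dom E c" "dual_map pa L = h" for L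
    proof -
      note r = dual_restr[OF F(1)]
      have LF: "Cod Dual L = Dom Dual (\<rho>\<^bsub>Dual\<^esub> ?F)" using r(2) F(2) L(2) by simp
      have "y \<in> {x \<in> Arr E. Cod E x = Dom E c \<and> pa x \<cdot>\<^bsub>B\<^esub> \<rho>\<^bsub>B\<^esub> (pa c) = pa x}"
        if "(x, y) \<in> action L" for x y
        using image[OF L that] actionD(2,5)[OF L(1) that] L(2) by simp
      then have "action (L \<cdot>\<^bsub>Dual\<^esub> \<rho>\<^bsub>Dual\<^esub> ?F) = action L"
        unfolding dual_comp(5)[OF L(1) r(1) LF] r(5) F(2,4) by auto
      then show ?thesis by (rule action_inject[OF dual_comp(1)[OF L(1) r(1) LF] L(1)])
    qed
    \<comment> \<open>The right-hand side does not mention L, so any two factorisations of G over h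
      have the same action.\<close>
    have act_iff: "(x, z) \<in> action L \<longleftrightarrow> z \<in> Arr E \<and> Cod E z = Dom E c \<and> z \<cdot>\<^bsub>E\<^esub> \<rho>\<^bsub>E\<^esub> c = z \<and>
        pa z = pa x \<cdot>\<^bsub>B\<^esub> h \<and> (x, z \<cdot>\<^bsub>E\<^esub> c) \<in> action G" (is "_ \<longleftrightarrow> ?R")
      if L: "L \<in> Arr Dual" "Cod Dual L = Dom E c" "dual_map pa L = h" "L \<cdot>\<^bsub>Dual\<^esub> ?F = G" for L x z
    proof -
      have LF: "Cod Dual L = Dom Dual ?F" using L(2) F(2) by simp
      have aG: "action G = action L O action ?F" using dual_comp(5)[OF L(1) F(1) LF] L(4) by simp
      have zc: "w \<cdot>\<^bsub>E\<^esub> \<rho>\<^bsub>E\<^esub> c = w" if w: "(x, w) \<in> action L" for w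
        using image[OF L(1-3) w] comp_restr_reflect[of w c] actionD(2,5)[OF L(1) w] c L(2) by simp
      show ?thesis
      proof
        assume xz: "(x, z) \<in> action L"
        note a = actionD[OF L(1) xz]
        have "(z, z \<cdot>\<^bsub>E\<^esub> c) \<in> action ?F" unfolding aF using a L(2) zc[OF xz] by simp
        then show ?R unfolding aG using xz a L(2,3) zc[OF xz] by auto
      next
        assume R: ?R
        then obtain w where xw: "(x, w) \<in> action L" and w: "(w, z \<cdot>\<^bsub>E\<^esub> c) \<in> action ?F"
          unfolding aG by blast
        note a = actionD[OF L(1) xw]
        have w': "w \<in> Arr E" "Cod E w = Dom E c" "w \<cdot>\<^bsub>E\<^esub> c = z \<cdot>\<^bsub>E\<^esub> c" using w by (simp_all add: aF)
        have "Dom E w = Dom E z" using E.arr_comp(2)[of w c] w' R c by simp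
        moreover have "pa w \<cdot>\<^bsub>B\<^esub> \<rho>\<^bsub>B\<^esub> (pa c) = pa w"
          using comp_restr_reflect[of w c] zc[OF xw] w' c by simp
        \<comment> \<open>Both maps lie over \<open>pa x \<cdot> h\<close> and have the same
          composite with c, so proneness of c identifies them.\<close>
        ultimately have "w = z"
          using Prone_cancel[OF assms, of w z] w' R a(6) L(3) by simp
        then show "(x, z) \<in> action L" using xw by simp
      qed
    qed
    show "\<exists>!K. K \<in> Hom Dual Y (Dom Dual ?F) \<and> dual_map pa K = h \<and> precise_triangle Dual K ?F G"
    proof (rule ex1I[of _ ?K])
      show "?K \<in> Hom Dual Y (Dom Dual ?F) \<and> dual_map pa ?K = h \<and> precise_triangle Dual ?K ?F G"
        using K KF KG F k d(2) precise[of ?K] by (simp add: D.Hom_iff D.precise_triangle_iff)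
      fix L assume "L \<in> Hom Dual Y (Dom Dual ?F) \<and> dual_map pa L = h \<and> precise_triangle Dual L ?F G"
      then have L: "L \<in> Arr Dual" "Cod Dual L = Dom E c" "dual_map pa L = h" "L \<cdot>\<^bsub>Dual\<^esub> ?F = G"
        using F by (simp_all add: D.Hom_iff D.precise_triangle_iff)
      have K': "Cod Dual ?K = Dom E c" "dual_map pa ?K = h" using K k by simp_all
      show "L = ?K"
      proof (rule action_inject[OF L(1) K(1)])
        show "action L = action ?K"
          using act_iff[OF L] act_iff[OF K(1) K' KG] by (intro set_eqI) auto
      qed
    qed
  qed (fact F(1))
qed

section \<open>The dual as a latent hyperfibration\<close>

lemma dual_latent_fibration: "latent_fibration Dual B po (dual_map pa)"
  unfolding latent_fibration_def
proof (intro conjI ballI impI)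
  show "restriction_semifunctor Dual B po (dual_map pa)" by (rule dual_semifunctor)
  fix X f assume "X \<in> Obj Dual" "f \<in> Arr B"
    and f: "Cod B f = po X \<and> f = f \<cdot>\<^bsub>B\<^esub> dual_map pa (Id Dual X)"
  then have X: "X \<in> Obj E" and "f \<in> Arr B" "Cod B f = po X" "f = f \<cdot>\<^bsub>B\<^esub> pa (Id E X)"
    using dual_id(4)[of X] by (simp_all add: fib_dual_sel(1))
  then obtain c where c: "Prone c" "Cod E c = X" "pa c = f" using prone_over by blast
  note s = span_class_arr[OF action_prone_span(1)[OF c(1)]]
  show "\<exists>F. prone Dual B po (dual_map pa) F \<and> Cod Dual F = X \<and> dual_map pa F = f"
    using dual_prone[OF c(1)] s(3,4) c(2,3) by blast
qed

text \<open>An idempotent of the dual is its own restriction, and the action of a restriction is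
  fixed by the object and the image in B; this gives injectivity. Surjectivity is inherited from E:
  an idempotent e over d yields the class of (e, e).\<close>

lemma dual_hyperconnected: "hyperconnected Dual B po (dual_map pa)"
  unfolding hyperconnected_def
proof (intro ballI conjI)
  interpret D: restriction_semifunctor Dual B po "dual_map pa" by (rule dual_semifunctor)
  fix X assume "X \<in> Obj Dual"
  then have X: "X \<in> Obj E" by (simp add: fib_dual_sel(1))
  show "bij_betw (dual_map pa) (ridem Dual X)
      {d \<in> ridem B (po X). d \<cdot>\<^bsub>B\<^esub> dual_map pa (Id Dual X) = d}"
  proof (rule bij_betwI')
    fix F G assume "F \<in> ridem Dual X" "G \<in> ridem Dual X"
    then have F: "F \<in> Arr Dual" "Dom Dual F = X" "\<rho>\<^bsub>Dual\<^esub> F = F"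
      and G: "G \<in> Arr Dual" "Dom Dual G = X" "\<rho>\<^bsub>Dual\<^esub> G = G"
      by (simp_all add: D.E.ridem_iff)
    show "dual_map pa F = dual_map pa G \<longleftrightarrow> F = G"
    proof
      assume "dual_map pa F = dual_map pa G"
      then have "action (\<rho>\<^bsub>Dual\<^esub> F) = action (\<rho>\<^bsub>Dual\<^esub> G)"
        unfolding dual_restr(5)[OF F(1)] dual_restr(5)[OF G(1)] F(2) G(2) by simp
      then show "F = G" unfolding F(3) G(3) by (rule action_inject[OF F(1) G(1)])
    qed simp
  next
    fix F assume F: "F \<in> ridem Dual X"
    then have "F \<in> Arr Dual" "Cod Dual F = X" by (simp_all add: D.E.ridem_iff)
    then show "dual_map pa F \<in> {d \<in> ridem B (po X). d \<cdot>\<^bsub>B\<^esub> dual_map pa (Id Dual X) = d}"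
      using D.pa_ridem[OF F] D.pa_comp_id by blast
  next
    fix d assume "d \<in> {d \<in> ridem B (po X). d \<cdot>\<^bsub>B\<^esub> dual_map pa (Id Dual X) = d}"
    then have "d \<in> ridem B (po X)" "d \<cdot>\<^bsub>B\<^esub> pa (Id E X) = d" unfolding dual_id(4)[OF X] by blast+
    then obtain e where e: "e \<in> ridem E X" "pa e = d" using X by (metis ridem_over)
    then have e': "Cod E e = X" "\<rho>\<^bsub>B\<^esub> d = d" using pa_ridem[OF e(1)] by (auto simp: E.ridem_iff B.ridem_iff)
    note s = span_ridem[OF e(1)]
    note c = span_class_arr[OF s(1)]
    note r = dual_restr[OF c(1)]
    have "\<rho>\<^bsub>Dual\<^esub> (span_class e e) = span_class e e"
    proof (rule action_inject[OF r(1) c(1)])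
      show "action (\<rho>\<^bsub>Dual\<^esub> (span_class e e)) = action (span_class e e)"
        unfolding r(5) c(2,4,5) s(2) e(2) e' ..
    qed
    then have "span_class e e \<in> ridem Dual X" using c e' by (simp add: D.E.ridem_iff)
    then show "\<exists>F\<in>ridem Dual X. d = dual_map pa F" by (rule rev_bexI) (simp only: c(4) e(2))
  qed
  fix F G assume "F \<in> ridem Dual X" "G \<in> ridem Dual X"
  then show "dual_map pa (F \<cdot>\<^bsub>Dual\<^esub> G) = dual_map pa F \<cdot>\<^bsub>B\<^esub> dual_map pa G"
    by (simp add: D.E.ridem_iff)
qed

end

theorem theorem6p5:
  fixes E :: "('o, 'm) rcat" and B :: "('p, 'n) rcat"
    and po :: "'o \<Rightarrow> 'p" and pa :: "'m \<Rightarrow> 'n"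
  assumes "latent_hyperfibration E B po pa"
  shows "latent_hyperfibration (fib_dual E B po pa) B po (dual_map pa)"
proof -
  have "restriction_semifunctor E B po pa"
    using assms by (simp add: latent_hyperfibration_def latent_fibration_def)
  moreover have "hyperfibration_axioms E B po pa"
    using assms by (simp add: latent_hyperfibration_def latent_fibration_def hyperfibration_axioms_def)
  ultimately interpret hyperfibration E B po pa by (rule hyperfibration.intro)
  show ?thesis
    unfolding latent_hyperfibration_def using dual_latent_fibration dual_hyperconnected ..
qed

end
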